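(* Let $q>0$ and let $T_q:\mathbb{T}\to\mathbb{T}$ be the Pomeau–Manneville map on the circle $\mathbb{T}=\mathbb{R}/\mathbb{Z}$ (parametrized by $[0,1)$), $T_q(x)=(1+(2x)^q)x$ for $x\in[0,\frac12]$ and $T_q(x)=2x-1$ for $x\in[\frac12,1)$ (values taken modulo $1$). Case $q<1$: let $\alpha,\gamma\in(0,1)$ be any numbers such that $\gamma-\alpha\ge q$, and let $V=\mathcal{C}^\gamma(\mathbb{T})$. Case $q\ge 1$: let $\gamma>q$ and $\alpha\in(0,1]$ be any numbers such that $\gamma+1-\alpha\ge q$, and let $V$ be the linear subspace of $\mathcal{C}^\alpha(\mathbb{T})$ made of the potentials $A$ that are continuously differentiable near $0$ and such that $A'(r)=O(|r|^\gamma)$ as $r\to0$. In both cases, for any potential $A\in V$ the transfer operator $\mathscr{L}_{T_q,A}$ acting on $\mathcal{C}^\alpha(\mathbb{T})$ satisfies a Ruelle–Perron–Frobenius theorem with a spectral gap. In particular the RPF measure $\mu_A$ has exponential decay of correlations for all Hölder observables (of any Hölder exponent).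
   Context: Function spaces: for $\alpha\in(0,1]$, $\mathcal{C}^\alpha(\mathbb{T})$ is the Banach space of functions $f:\mathbb{T}\to\mathbb{R}$ with $|f(x)-f(y)|\le C\,d(x,y)^\alpha$ for some $C$ (least such $C$ denoted $\mathrm{Hol}_\alpha(f)$), with norm $\|f\|_\infty+\mathrm{Hol}_\alpha(f)$; $\mathcal{C}^1$ means Lipschitz. $d$ is the usual distance on the circle. Transfer operator: for a map $T$ and a potential $A$, $\mathscr{L}_{T,A}f(x)=\sum_{T(y)=x}e^{A(y)}f(y)$. An operator $\mathscr{L}=\mathscr{L}_{T,A}$ acting continuously on a Banach space $\mathcal{X}$ of functions satisfies a Ruelle–Perron–Frobenius (RPF) theorem on $\mathcal{X}$ if there exist a positive function $h\in\mathcal{X}$, a constant $\rho>0$ and a nonzero positive finite measure $\nu$ such that $\mathscr{L}h=\rho h$ and $\mathscr{L}^*\nu=\rho\nu$ (i.e. $\int\mathscr{L}f\,d\nu=\rho\int f\,d\nu$ for all $f\in\mathcal{X}$). The RPF measure is the probability measure $\mu_A$ with $d\mu_A=h\,d\nu$, $h$ being suitably scaled. The operator has a spectral gap if moreover there are $C\ge1$, $\delta\in(0,1)$ such that for all $t\in\mathbb{N}$ and all $f\in\mathcal{X}$ with $\nu(f)=0$, $\|\mathscr{L}^tf\|\le C\rho^t(1-\delta)^t\|f\|$. Exponential decay of correlations for all Hölder observables: for every $a\in(0,1]$ there are $C>0$, $\delta\in(0,1)$ such that for all $f\in\mathcal{C}^a(\mathbb{T})$, $g\in L^1(\mu_A)$,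 $t\in\mathbb{N}$: $\left|\int f\cdot g\circ T^t\,d\mu_A-\int f\,d\mu_A\int g\,d\mu_A\right|\le C(1-\delta)^t\,\mathrm{Hol}_a(f)\,\|g\|_{L^1(\mu_A)}$. *)

theory Defs
  imports "HOL-Probability.Probability"
begin

section \<open>The circle\<close>

text \<open>The circle \<open>\<real> / \<int>\<close>, parametrized by \<open>[0,1)\<close>; \<open>circle_of\<close> is the
  projection from the real line.\<close>

typedef circle = "{0..<1::real}"
  morphisms coord Abs_circle
  by (rule exI[of _ 0]) simp

definition circle_of :: "real \<Rightarrow> circle"
  where "circle_of r = Abs_circle (frac r)"

lemma coord_circle_of [simp]: "coord (circle_of r) = frac r"
  by (simp add: circle_of_def Abs_circle_inverse frac_lt_1)

lemma circle_of_coord [simp]: "circle_of (coord x) = x"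
  using coord[of x] by (simp add: circle_of_def frac_eq coord_inverse)

instantiation circle :: metric_space
begin

definition dist_circle :: "circle \<Rightarrow> circle \<Rightarrow> real"
  where "dist x y = min \<bar>coord x - coord y\<bar> (1 - \<bar>coord x - coord y\<bar>)"

definition uniformity_circle :: "(circle \<times> circle) filter"
  where "(uniformity :: (circle \<times> circle) filter) = (INF e\<in>{0<..}. principal {(x, y). dist x y < e})"

definition open_circle :: "circle set \<Rightarrow> bool"
  where "open (U :: circle set) \<longleftrightarrow> (\<forall>x\<in>U. \<forall>\<^sub>F (x', y) in uniformity. x' = x \<longrightarrow> y \<in> U)"

instance
proof
  fix x y z :: circle
  have "0 \<le> coord x" "coord x < 1" "0 \<le> coord y" "coord y < 1" "0 \<le> coord z" "coord z < 1"
    using coord[of x] coord[of y] coord[of z] by auto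
  then show "dist x y = 0 \<longleftrightarrow> x = y" "dist x y \<le> dist x z + dist y z"
    by (auto simp: dist_circle_def coord_inject[symmetric] min_def abs_if)
qed (rule uniformity_circle_def open_circle_def)+

end

section \<open>Hoelder spaces\<close>

definition holder_const :: "real \<Rightarrow> (circle \<Rightarrow> real) \<Rightarrow> real"
  where "holder_const \<alpha> f = Inf {C. \<forall>x y. \<bar>f x - f y\<bar> \<le> C * dist x y powr \<alpha>}"

definition holder_space :: "real \<Rightarrow> (circle \<Rightarrow> real) set"
  where "holder_space \<alpha> = {f. \<exists>C. \<forall>x y. \<bar>f x - f y\<bar> \<le> C * dist x y powr \<alpha>}"

definition holder_norm :: "real \<Rightarrow> (circle \<Rightarrow> real) \<Rightarrow> real"
  where "holder_norm \<alpha> f = (SUP x. \<bar>f x\<bar>) + holder_const \<alpha> f"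

text \<open>Derivatives of a function on the circle are those of its periodic lift to the real line,
  so that both sides of \<open>0\<close> are taken into account.\<close>

definition flat_at_0_potentials :: "real \<Rightarrow> real \<Rightarrow> (circle \<Rightarrow> real) set"
  where "flat_at_0_potentials \<alpha> \<gamma> =
    {A \<in> holder_space \<alpha>. \<exists>A' \<epsilon>. \<epsilon> > 0 \<and>
        (\<forall>r\<in>{-\<epsilon><..<\<epsilon>}. ((\<lambda>s. A (circle_of s)) has_real_derivative A' r) (at r)) \<and>
        continuous_on {-\<epsilon><..<\<epsilon>} A' \<and>
        A' \<in> O[at 0](\<lambda>r. \<bar>r\<bar> powr \<gamma>)}"

section \<open>Transfer operators and the Ruelle--Perron--Frobenius property\<close>

definition pomeau_manneville :: "real \<Rightarrow> circle \<Rightarrow> circle"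
  where "pomeau_manneville q x = circle_of
    (if coord x \<le> 1/2 then (1 + (2 * coord x) powr q) * coord x else 2 * coord x - 1)"

text \<open>The sum is meaningful for finite-to-one maps, such as the Pomeau--Manneville maps, which are
  two-to-one.\<close>

definition transfer_op :: "('a \<Rightarrow> 'a) \<Rightarrow> ('a \<Rightarrow> real) \<Rightarrow> ('a \<Rightarrow> real) \<Rightarrow> 'a \<Rightarrow> real"
  where "transfer_op T A f x = (\<Sum>y | T y = x. exp (A y) * f y)"

text \<open>In the following, a Banach space of functions is given by its set \<open>X\<close> of elements and its
  norm \<open>N\<close>.\<close>

definition acts_continuously_on ::
    "('a \<Rightarrow> real) set \<Rightarrow> (('a \<Rightarrow> real) \<Rightarrow> real) \<Rightarrow> (('a \<Rightarrow> real) \<Rightarrow> 'a \<Rightarrow> real) \<Rightarrow> bool"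
  where "acts_continuously_on X N L \<longleftrightarrow>
    (\<forall>f\<in>X. L f \<in> X) \<and>
    (\<forall>f\<in>X. \<forall>g\<in>X. L (\<lambda>x. f x + g x) = (\<lambda>x. L f x + L g x)) \<and>
    (\<forall>f\<in>X. \<forall>c. L (\<lambda>x. c * f x) = (\<lambda>x. c * L f x)) \<and>
    (\<exists>C. \<forall>f\<in>X. N (L f) \<le> C * N f)"

definition rpf_triple ::
    "('a::topological_space \<Rightarrow> real) set \<Rightarrow> (('a \<Rightarrow> real) \<Rightarrow> 'a \<Rightarrow> real) \<Rightarrow>
     ('a \<Rightarrow> real) \<Rightarrow> real \<Rightarrow> 'a measure \<Rightarrow> bool"
  where "rpf_triple X L h \<rho> \<nu> \<longleftrightarrow>
    h \<in> X \<and> (\<forall>x. h x > 0) \<and> \<rho> > 0 \<and>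
    sets \<nu> = sets borel \<and> finite_measure \<nu> \<and> emeasure \<nu> (space \<nu>) \<noteq> 0 \<and>
    L h = (\<lambda>x. \<rho> * h x) \<and>
    (\<forall>f\<in>X. (\<integral>x. L f x \<partial>\<nu>) = \<rho> * (\<integral>x. f x \<partial>\<nu>))"

definition rpf_with_spectral_gap ::
    "('a::topological_space \<Rightarrow> real) set \<Rightarrow> (('a \<Rightarrow> real) \<Rightarrow> real) \<Rightarrow>
     (('a \<Rightarrow> real) \<Rightarrow> 'a \<Rightarrow> real) \<Rightarrow> bool"
  where "rpf_with_spectral_gap X N L \<longleftrightarrow>
    acts_continuously_on X N L \<and>
    (\<exists>h \<rho> \<nu>. rpf_triple X L h \<rho> \<nu> \<and>
      (\<exists>C \<delta>. C \<ge> 1 \<and> 0 < \<delta> \<and> \<delta> < 1 \<and>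
        (\<forall>t. \<forall>f\<in>X. (\<integral>x. f x \<partial>\<nu>) = 0 \<longrightarrow>
          N ((L ^^ t) f) \<le> C * \<rho> ^ t * (1 - \<delta>) ^ t * N f)))"

definition rpf_measure ::
    "('a::topological_space \<Rightarrow> real) set \<Rightarrow> (('a \<Rightarrow> real) \<Rightarrow> 'a \<Rightarrow> real) \<Rightarrow> 'a measure \<Rightarrow> bool"
  where "rpf_measure X L \<mu> \<longleftrightarrow>
    prob_space \<mu> \<and> (\<exists>h \<rho> \<nu>. rpf_triple X L h \<rho> \<nu> \<and> \<mu> = density \<nu> (\<lambda>x. ennreal (h x)))"

definition exp_decay_of_correlations :: "(circle \<Rightarrow> circle) \<Rightarrow> circle measure \<Rightarrow> bool"
  where "exp_decay_of_correlations T \<mu> \<longleftrightarrow>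
    (\<forall>a. 0 < a \<and> a \<le> 1 \<longrightarrow>
      (\<exists>C \<delta>. C > 0 \<and> 0 < \<delta> \<and> \<delta> < 1 \<and>
        (\<forall>f\<in>holder_space a. \<forall>g. integrable \<mu> g \<longrightarrow> (\<forall>t.
          \<bar>(\<integral>x. f x * g ((T ^^ t) x) \<partial>\<mu>) - (\<integral>x. f x \<partial>\<mu>) * (\<integral>x. g x \<partial>\<mu>)\<bar>
            \<le> C * (1 - \<delta>) ^ t * holder_const a f * (\<integral>x. \<bar>g x\<bar> \<partial>\<mu>)))))"

end

theory Submission
  imports Defs
begin

text \<open>Any two points of the circle have preimages that can be paired off so that both pairs are
  not farther apart than the original points and one of them is at most half as far apart.
  The neutral branch separates two points at distance \<open>d'\<close> by at least a multiple of
  \<open>d'\<close> to the power \<open>1 + q\<close>, so the assumptions on \<open>A\<close> yield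
  \<open>\<bar>A x' - A y'\<bar> \<le> K (d(x,y)\<^sup>\<alpha> - d(x',y')\<^sup>\<alpha>)\<close> for every such pair \<open>x', y'\<close> of preimages.
  Hence the transfer operator preserves the cone of functions whose
  logarithm is \<open>\<alpha>\<close>-Hoelder with constant \<open>K\<close>. Normalizing by a sequence \<open>h\<^sub>n\<close> in this cone with
  \<open>L h\<^sub>n = h\<^sub>n\<^sub>+\<^sub>1\<close> turns \<open>L\<close> into Markov averages over the preimages, with uniformly positive weights
  that depend on the base point in a uniformly Hoelder way. The contracting pair then makes the
  Hoelder constant decay exponentially. With \<open>h\<^sub>n = L\<^sup>n 1\<close> this gives the eigenmeasure as a weak
  limit, the eigenvalue, the eigenfunction as the limit of \<open>\<rho>\<^sup>-\<^sup>n L\<^sup>n 1\<close>, and the spectral gap; with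
  \<open>h\<^sub>n = \<rho>\<^sup>n h\<close>, for any eigenfunction \<open>h\<close>, it gives the decay of correlations.\<close>

section \<open>Hoelder and log-Hoelder functions\<close>

text \<open>At the neutral fixed point 0 the left branch has slope 1, so expansion is not uniform.
  The conditions on \<alpha>, \<gamma> and q provide a budget: a neutral pair at distance d' whose
  images are at distance d satisfies d^\<alpha> - d'^\<alpha> \<ge> const * d'^(\<alpha>+q), so a
  variation of A of that order is paid for by the expansion itself. For q < 1 this is \<gamma> \<ge>
  \<alpha> + q. For q \<ge> 1 the exponent \<alpha> + q exceeds 1 and only constants are Hoelder of
  that order, so the budget is met through A'(r) = O(|r|^\<gamma>): \<gamma> > q serves pairs on one
  side of 0, and \<gamma> + 1 \<ge> \<alpha> + q serves pairs on both sides. The Markov averages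
  vary with the base point, and this feeds the oscillation of a function back into its Hoelder
  constant. The two quantities therefore have to be contracted together. Flatness enters only
  through the invariance of the cone. The contraction works at any exponent for which the
  normalizers are uniformly log-Hoelder, so the decay of correlations can be run at the exponent min
  a \<alpha>.\<close>

definition holder_with :: "real \<Rightarrow> real \<Rightarrow> ('a::metric_space \<Rightarrow> real) \<Rightarrow> bool"
  where "holder_with a H f \<longleftrightarrow> (\<forall>x y. \<bar>f x - f y\<bar> \<le> H * dist x y powr a)"

text \<open>The multiplicative form of Hoelder continuity is stable under sums, positive multiples
  and limits that stay positive, so it describes a cone on which a positive operator can
  act.\<close>

definition log_holder_with :: "real \<Rightarrow> real \<Rightarrow> ('a::metric_space \<Rightarrow> real) \<Rightarrow> bool"
  where "log_holder_with a K h \<longleftrightarrow>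
    (\<forall>x. 0 < h x) \<and> (\<forall>x y. h x \<le> exp (K * dist x y powr a) * h y)"

text \<open>Index 0 marks the pair that merely does not expand, index 1 the pair contracted by
  \<theta>. The matching may depend on \<open>x\<close> and \<open>y\<close>: the inverse branches
  of a degree-two circle map cannot be labelled continuously, and points on either side of 0 are
  matched crosswise. Knowing the exact fibres turns \<open>transfer_op\<close> into a two-term
  sum.\<close>

definition pairing ::
    "('a::metric_space \<Rightarrow> 'a) \<Rightarrow> real \<Rightarrow> 'a \<Rightarrow> 'a \<Rightarrow> 'a \<Rightarrow> 'a \<Rightarrow> 'a \<Rightarrow> 'a \<Rightarrow> bool"
  where "pairing T \<theta> x y x0 x1 y0 y1 \<longleftrightarrow>
    {z. T z = x} = {x0, x1} \<and> x0 \<noteq> x1 \<and> {z. T z = y} = {y0, y1} \<and> y0 \<noteq> y1 \<and>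
    dist x0 y0 \<le> dist x y \<and> dist x1 y1 \<le> \<theta> * dist x y"

lemma holder_withD: "holder_with a H f \<Longrightarrow> \<bar>f x - f y\<bar> \<le> H * dist x y powr a"
  by (simp add: holder_with_def)

lemma log_holder_withD:
  assumes "log_holder_with a K h"
  shows "0 < h x" "h x \<le> exp (K * dist x y powr a) * h y"
  using assms by (auto simp: log_holder_with_def)

lemma log_holder_with_cmult:
  assumes "log_holder_with a K h" "0 < c"
  shows "log_holder_with a K (\<lambda>x. c * h x)"
  using assms by (auto simp: log_holder_with_def algebra_simps)

lemma holder_with_add:
  assumes "holder_with a H f" "holder_with a H' g"
  shows "holder_with a (H + H') (\<lambda>x. f x + g x)"
  unfolding holder_with_def
proof (intro allI)
  fix x y
  show "\<bar>f x + g x - (f y + g y)\<bar> \<le> (H + H') * dist x y powr a"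
    using holder_withD[OF assms(1), of x y] holder_withD[OF assms(2), of x y]
    by (simp add: algebra_simps)
qed

lemma holder_with_const: "0 \<le> H \<Longrightarrow> holder_with a H (\<lambda>x. c)"
  by (simp add: holder_with_def)

lemma holder_with_mult:
  assumes f: "holder_with a H f" "\<And>x. \<bar>f x\<bar> \<le> M" and g: "holder_with a H' g" "\<And>x. \<bar>g x\<bar> \<le> M'"
  shows "holder_with a (M * H' + M' * H) (\<lambda>x. f x * g x)"
  unfolding holder_with_def
proof (intro allI)
  fix x y
  have "\<bar>f x * g x - f y * g y\<bar> = \<bar>f x * (g x - g y) + g y * (f x - f y)\<bar>"
    by (simp add: algebra_simps)
  also have "\<dots> \<le> \<bar>f x\<bar> * \<bar>g x - g y\<bar> + \<bar>g y\<bar> * \<bar>f x - f y\<bar>"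
    by (rule order_trans[OF abs_triangle_ineq]) (simp add: abs_mult)
  also have "\<dots> \<le> M * (H' * dist x y powr a) + M' * (H * dist x y powr a)"
    by (intro add_mono mult_mono' holder_withD assms) auto
  finally show "\<bar>f x * g x - f y * g y\<bar> \<le> (M * H' + M' * H) * dist x y powr a"
    by (simp add: algebra_simps)
qed

lemma holder_with_imp_continuous:
  fixes f :: "'a::metric_space \<Rightarrow> real"
  assumes f: "holder_with a H f" and a: "0 < a"
  shows "continuous_on UNIV f"
proof (rule continuous_at_imp_continuous_on, safe)
  fix x :: 'a
  have "((\<lambda>y. H * dist y x powr a) \<longlongrightarrow> H * 0 powr a) (at x)"
    by (rule tendsto_mult_left, rule tendsto_powr2, rule tendsto_eq_intros) (use a in \<open>auto intro: tendsto_eq_intros\<close>)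
  hence "((\<lambda>y. H * dist y x powr a) \<longlongrightarrow> 0) (at x)" by simp
  hence "((\<lambda>y. f y - f x) \<longlongrightarrow> 0) (at x)"
    by (rule Lim_null_comparison[rotated]) (use f in \<open>auto simp: holder_with_def\<close>)
  thus "isCont f x"
    by (simp add: isCont_def LIM_zero_iff)
qed

lemma holder_with_measurable [measurable_dest]:
  assumes "holder_with a H f" "0 < a"
  shows "f \<in> borel_measurable borel"
  using holder_with_imp_continuous[OF assms] by (rule borel_measurable_continuous_onI)

text \<open>Since 1 - t \<le> exp (-t), a ratio bound becomes a difference bound relative to
  \<open>p\<close> alone. Applied in both orders of two points, it bounds an absolute value.\<close>

lemma diff_le_of_le_exp_mult:
  fixes p r t :: real
  assumes "p \<le> exp t * r" "0 \<le> p"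
  shows "p - r \<le> t * p"
proof -
  have "exp (-t) * p \<le> r"
    using assms(1) by (simp add: exp_minus field_simps)
  moreover have "(1 - t) * p \<le> exp (-t) * p"
    using exp_ge_add_one_self[of "-t"] assms by (intro mult_right_mono) auto
  ultimately show ?thesis by (simp add: algebra_simps)
qed

lemma log_holder_with_imp_holder_with:
  assumes h: "log_holder_with a K h" and K: "0 \<le> K" and M: "\<And>x. h x \<le> M"
  shows "holder_with a (K * M) h"
proof -
  have *: "h x - h y \<le> K * M * dist x y powr a" for x y
  proof -
    have "h x - h y \<le> (K * dist x y powr a) * h x"
      using log_holder_withD[OF h] by (intro diff_le_of_le_exp_mult) (auto simp: less_imp_le)
    also have "\<dots> \<le> (K * dist x y powr a) * M"
      using K M by (intro mult_left_mono) auto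
    finally show ?thesis by (simp add: mult_ac)
  qed
  show ?thesis
    unfolding holder_with_def
  proof (intro allI)
    show "\<bar>h x - h y\<bar> \<le> K * M * dist x y powr a" for x y
      using *[of x y] *[of y x] by (simp add: abs_le_iff dist_commute)
  qed
qed

section \<open>Contraction of Hoelder constants under paired preimages\<close>

locale paired_map =
  fixes T :: "'a::metric_space \<Rightarrow> 'a" and \<theta> :: real
  assumes theta: "0 < \<theta>" "\<theta> < 1"
    and dist_le_1: "dist (x::'a) y \<le> 1"
    and ex_pairing: "\<exists>x0 x1 y0 y1. pairing T \<theta> x y x0 x1 y0 y1"
begin

lemma dist_powr_le_1: "0 \<le> a \<Longrightarrow> dist (x::'a) y powr a \<le> 1"
  using dist_le_1[of x y] by (intro powr_le1) auto

lemma transfer_op_pairing: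
  assumes "pairing T \<theta> x y x0 x1 y0 y1"
  shows "transfer_op T A f x = exp (A x0) * f x0 + exp (A x1) * f x1"
    "transfer_op T A f y = exp (A y0) * f y0 + exp (A y1) * f y1"
  using assms by (simp_all add: transfer_op_def pairing_def)

lemma holder_with_mono:
  fixes f :: "'a \<Rightarrow> real"
  assumes "holder_with b H f" "a \<le> b" "H \<le> H'" "0 \<le> H"
  shows "holder_with a H' f"
  unfolding holder_with_def
proof (intro allI)
  fix x y
  have "\<bar>f x - f y\<bar> \<le> H * dist x y powr b" by (rule holder_withD[OF assms(1)])
  also have "\<dots> \<le> H' * dist x y powr a"
    using assms dist_le_1[of x y] by (intro mult_mono powr_mono') auto
  finally show "\<bar>f x - f y\<bar> \<le> H' * dist x y powr a" .
qed

lemma holder_with_osc: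
  fixes f :: "'a \<Rightarrow> real"
  assumes "holder_with a H f" "0 \<le> a" "0 \<le> H"
  shows "\<bar>f x - f y\<bar> \<le> H"
proof -
  have "\<bar>f x - f y\<bar> \<le> H * dist x y powr a" by (rule holder_withD[OF assms(1)])
  also have "\<dots> \<le> H * 1"
    using assms by (intro mult_left_mono dist_powr_le_1) auto
  finally show ?thesis by simp
qed

lemma log_holder_with_le:
  fixes h :: "'a \<Rightarrow> real"
  assumes "log_holder_with a K h" "0 \<le> a" "0 \<le> K"
  shows "h x \<le> exp K * h y"
proof -
  have "h x \<le> exp (K * dist x y powr a) * h y" by (rule log_holder_withD(2)[OF assms(1)])
  also have "\<dots> \<le> exp K * h y"
    using assms dist_powr_le_1[of a x y] log_holder_withD(1)[OF assms(1), of y]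
    by (intro mult_right_mono) (auto intro: mult_left_le)
  finally show ?thesis .
qed

text \<open>Dividing by \<open>h'\<close> turns the operator into an average: a preimage
  \<open>z\<close> of \<open>w\<close> gets the weight \<open>exp (A z) * h z / h' w\<close>, and
  the two weights add up to 1 because the operator maps \<open>h\<close> to \<open>h'\<close>. Their
  ratio is at most exp (KA + K), the diameter being at most 1, whence the lower bounds. Comparing
  matched preimages collects KA from A and K from each of \<open>h\<close> and
  \<open>h'\<close>.\<close>

lemma markov_weights:
  fixes A h h' f f' :: "'a \<Rightarrow> real"
  assumes a: "0 < a" and KA: "0 \<le> KA" and K: "0 \<le> K" and A: "holder_with a KA A"
    and h: "log_holder_with a K h" "log_holder_with a K h'"
    and Lh: "transfer_op T A h = h'"
    and Lf: "transfer_op T A (\<lambda>z. f z * h z) = (\<lambda>z. f' z * h' z)"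
    and P: "pairing T \<theta> x y x0 x1 y0 y1"
  obtains p0 p1 q0 q1 where
    "p0 + p1 = 1" "1 / (1 + exp (KA + K)) \<le> p0" "1 / (1 + exp (KA + K)) \<le> p1"
    "q0 + q1 = 1" "1 / (1 + exp (KA + K)) \<le> q0" "1 / (1 + exp (KA + K)) \<le> q1"
    "\<bar>p0 - q0\<bar> \<le> (KA + 2 * K) * dist x y powr a"
    "f' x = p0 * f x0 + p1 * f x1" "f' y = q0 * f y0 + q1 * f y1"
proof -
  define p where "p z w = exp (A z) * h z / h' w" for z w
  note pos = log_holder_withD(1)[OF h(1)] log_holder_withD(1)[OF h(2)]
  have p_pos: "0 < p z w" for z w
    using pos by (simp add: p_def)
  have A_le: "exp (A z) \<le> exp (KA * dist z w powr a) * exp (A w)" for z w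
    using holder_withD[OF A, of z w] by (simp flip: exp_add)
  have comp: "p z w \<le> exp (KA + K) * p z' w" for z z' w
  proof -
    have "exp (A z) \<le> exp KA * exp (A z')"
      using holder_with_osc[OF A, of z z'] a KA by (simp flip: exp_add)
    hence "exp (A z) * h z \<le> (exp KA * exp (A z')) * (exp K * h z')"
      using log_holder_with_le[OF h(1), of z z'] a K pos(1)[of z]
      by (intro mult_mono) (auto simp: less_imp_le)
    thus ?thesis
      using pos(2)[of w] by (simp add: p_def exp_add field_simps)
  qed
  have low: "1 / (1 + exp (KA + K)) \<le> p z w" if "p z w + p z' w = 1" for z z' w
    using comp[of z' w z] that by (simp add: field_simps add_pos_pos)
  have sum1: "p x0 x + p x1 x = 1" "p y0 y + p y1 y = 1"
    using transfer_op_pairing[OF P, of A h] pos(2)[of x] pos(2)[of y] unfolding Lh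
    by (simp_all add: p_def flip: add_divide_distrib)
  have val: "f' x = p x0 x * f x0 + p x1 x * f x1" "f' y = p y0 y * f y0 + p y1 y * f y1"
    using transfer_op_pairing[OF P, of A "\<lambda>z. f z * h z"] pos(2)[of x] pos(2)[of y] unfolding Lf
    by (simp_all add: p_def field_simps)
  have diff: "p z v - p z' w \<le> (KA + 2 * K) * dist v w powr a"
    if "dist z z' \<le> dist v w" "p z v \<le> 1" for z z' v w
  proof -
    have "exp (A z) * h z * h' w \<le>
        (exp (KA * dist z z' powr a) * exp (A z')) * (exp (K * dist z z' powr a) * h z') *
        (exp (K * dist w v powr a) * h' v)"
      by (intro mult_mono A_le log_holder_withD(2) h mult_nonneg_nonneg)
         (use pos in \<open>auto simp: less_imp_le\<close>)
    also have "\<dots> = exp (KA * dist z z' powr a + K * dist z z' powr a + K * dist v w powr a) *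
        (exp (A z') * h z' * h' v)"
      by (simp add: exp_add dist_commute)
    also have "\<dots> \<le> exp ((KA + 2 * K) * dist v w powr a) * (exp (A z') * h z' * h' v)"
    proof (intro mult_right_mono)
      have "dist z z' powr a \<le> dist v w powr a"
        using that a by (intro powr_mono2) auto
      hence "KA * dist z z' powr a + K * dist z z' powr a \<le> KA * dist v w powr a + K * dist v w powr a"
        using KA K by (intro add_mono mult_left_mono) auto
      thus "exp (KA * dist z z' powr a + K * dist z z' powr a + K * dist v w powr a)
          \<le> exp ((KA + 2 * K) * dist v w powr a)"
        by (simp add: algebra_simps)
    qed (use pos in \<open>auto simp: less_imp_le\<close>)
    finally have "p z v \<le> exp ((KA + 2 * K) * dist v w powr a) * p z' w"
      using pos(2)[of v] pos(2)[of w] by (simp add: p_def field_simps)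
    hence "p z v - p z' w \<le> ((KA + 2 * K) * dist v w powr a) * p z v"
      using p_pos[of z v] by (intro diff_le_of_le_exp_mult) auto
    also have "\<dots> \<le> (KA + 2 * K) * dist v w powr a"
      using that p_pos[of z v] KA K by (intro mult_left_le) auto
    finally show ?thesis .
  qed
  have d0: "dist x0 y0 \<le> dist x y"
    using P by (simp add: pairing_def)
  have "\<bar>p x0 x - p y0 y\<bar> \<le> (KA + 2 * K) * dist x y powr a"
    using diff[of x0 y0 x y] diff[of y0 x0 y x] d0 sum1 p_pos[of x1 x] p_pos[of y1 y]
    by (auto simp: dist_commute abs_le_iff)
  moreover have "p x1 x + p x0 x = 1" "p y1 y + p y0 y = 1" using sum1 by simp_all
  ultimately show ?thesis
    using that sum1 val low by blast
qed

text \<open>A Doeblin-Fortet (Lasota-Yorke) inequality: the contracted pair carries a weight bounded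
  below and lowers the Hoelder constant, while the change of weights between base points only sees
  the oscillation \<open>s\<close>.\<close>

lemma holder_step:
  fixes A h h' f f' :: "'a \<Rightarrow> real"
  assumes a: "0 < a" and KA: "0 \<le> KA" and K: "0 \<le> K" and A: "holder_with a KA A"
    and h: "log_holder_with a K h" "log_holder_with a K h'"
    and Lh: "transfer_op T A h = h'"
    and Lf: "transfer_op T A (\<lambda>z. f z * h z) = (\<lambda>z. f' z * h' z)"
    and f: "holder_with a H f" "0 \<le> H" "\<And>x y. \<bar>f x - f y\<bar> \<le> s"
  shows "holder_with a ((1 - (1 - \<theta> powr a) / (1 + exp (KA + K))) * H + (KA + 2 * K) * s) f'"
  unfolding holder_with_def
proof (intro allI)
  fix x y
  define \<epsilon> where "\<epsilon> = 1 / (1 + exp (KA + K))"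
  obtain x0 x1 y0 y1 where P: "pairing T \<theta> x y x0 x1 y0 y1" using ex_pairing by blast
  obtain p0 p1 q0 q1 where w: "p0 + p1 = 1" "\<epsilon> \<le> p0" "\<epsilon> \<le> p1"
    "q0 + q1 = 1" "\<epsilon> \<le> q0" "\<epsilon> \<le> q1" "\<bar>p0 - q0\<bar> \<le> (KA + 2 * K) * dist x y powr a"
    "f' x = p0 * f x0 + p1 * f x1" "f' y = q0 * f y0 + q1 * f y1"
    unfolding \<epsilon>_def by (rule markov_weights[OF a KA K A h Lh Lf P]) blast
  have eps: "0 < \<epsilon>" by (simp add: \<epsilon>_def add_pos_pos)
  define D where "D = dist x y powr a"
  have D: "0 \<le> D" by (simp add: D_def)
  have tha: "\<theta> powr a \<le> 1" using theta a by (intro powr_le1) auto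
  have d0: "\<bar>f x0 - f y0\<bar> \<le> H * D"
  proof -
    have "\<bar>f x0 - f y0\<bar> \<le> H * dist x0 y0 powr a" by (rule holder_withD[OF f(1)])
    also have "\<dots> \<le> H * D"
      unfolding D_def using P a f(2) by (intro mult_left_mono powr_mono2) (auto simp: pairing_def)
    finally show ?thesis .
  qed
  have d1: "\<bar>f x1 - f y1\<bar> \<le> H * (\<theta> powr a * D)"
  proof -
    have "\<bar>f x1 - f y1\<bar> \<le> H * dist x1 y1 powr a" by (rule holder_withD[OF f(1)])
    also have "\<dots> \<le> H * (\<theta> * dist x y) powr a"
      using P a f(2) by (intro mult_left_mono powr_mono2) (auto simp: pairing_def)
    finally show ?thesis using theta by (simp add: powr_mult D_def)
  qed
  \<comment> \<open>Both pairs of weights sum to 1, so the change of weights multiplies only the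
    difference of the two values of \<open>f\<close> over \<open>y\<close>.\<close>
  have p01: "p1 = 1 - p0" "q1 = 1 - q0" using w by simp_all
  have "f' x - f' y = p0 * (f x0 - f y0) + p1 * (f x1 - f y1) + (p0 - q0) * (f y0 - f y1)"
    unfolding w p01 by (simp add: algebra_simps)
  also have "\<bar>\<dots>\<bar> \<le> p0 * \<bar>f x0 - f y0\<bar> + p1 * \<bar>f x1 - f y1\<bar> + \<bar>p0 - q0\<bar> * \<bar>f y0 - f y1\<bar>"
    by (intro order_trans[OF abs_triangle_ineq] add_mono) (use w eps in \<open>auto simp: abs_mult\<close>)
  also have "\<dots> \<le> p0 * (H * D) + p1 * (H * (\<theta> powr a * D)) + ((KA + 2 * K) * D) * s"
  proof -
    have "0 \<le> (KA + 2 * K) * D" using KA K D by simp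
    hence "\<bar>p0 - q0\<bar> * \<bar>f y0 - f y1\<bar> \<le> ((KA + 2 * K) * D) * s"
      using w(7) f(3)[of y0 y1] by (intro mult_mono) (auto simp: D_def)
    thus ?thesis
      using w eps d0 d1 by (intro add_mono mult_left_mono) auto
  qed
  also have "\<dots> = H * D - p1 * ((1 - \<theta> powr a) * (H * D)) + (KA + 2 * K) * s * D"
    unfolding p01 by (simp add: algebra_simps)
  also have "\<dots> \<le> H * D - \<epsilon> * ((1 - \<theta> powr a) * (H * D)) + (KA + 2 * K) * s * D"
    using w tha D f(2) by (intro add_right_mono diff_left_mono mult_right_mono) auto
  also have "\<dots> = ((1 - (1 - \<theta> powr a) * \<epsilon>) * H + (KA + 2 * K) * s) * D"
    by (simp add: algebra_simps)
  finally show "\<bar>f' x - f' y\<bar> \<le>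
      ((1 - (1 - \<theta> powr a) / (1 + exp (KA + K))) * H + (KA + 2 * K) * s) * dist x y powr a"
    by (simp add: \<epsilon>_def D_def)
qed

text \<open>A coupling argument: mass 1 / (1 + exp (KA + K)) of both averages is carried jointly by
  the contracted pair, and all other mass is charged the full oscillation \<open>s\<close>. The
  variation of the weights does not enter, so the bound can be iterated.\<close>

lemma osc_step:
  fixes A h h' f f' :: "'a \<Rightarrow> real"
  assumes a: "0 < a" and KA: "0 \<le> KA" and K: "0 \<le> K" and A: "holder_with a KA A"
    and h: "log_holder_with a K h" "log_holder_with a K h'"
    and Lh: "transfer_op T A h = h'"
    and Lf: "transfer_op T A (\<lambda>z. f z * h z) = (\<lambda>z. f' z * h' z)"
    and f: "\<And>x y. \<bar>f x - f y\<bar> \<le> s" "\<And>x y. \<bar>f x - f y\<bar> \<le> b + c * dist x y powr a" and c: "0 \<le> c"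
  shows "\<bar>f' x - f' y\<bar> \<le> (1 - 1 / (1 + exp (KA + K))) * s +
           1 / (1 + exp (KA + K)) * (b + c * \<theta> powr a * dist x y powr a)"
proof -
  define \<epsilon> where "\<epsilon> = 1 / (1 + exp (KA + K))"
  have *: "f' x - f' y \<le> (1 - \<epsilon>) * s + \<epsilon> * (b + c * \<theta> powr a * dist x y powr a)" for x y
  proof -
    obtain x0 x1 y0 y1 where P: "pairing T \<theta> x y x0 x1 y0 y1" using ex_pairing by blast
    obtain p0 p1 q0 q1 where w: "p0 + p1 = 1" "\<epsilon> \<le> p0" "\<epsilon> \<le> p1"
      "q0 + q1 = 1" "\<epsilon> \<le> q0" "\<epsilon> \<le> q1"
      "f' x = p0 * f x0 + p1 * f x1" "f' y = q0 * f y0 + q1 * f y1"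
      unfolding \<epsilon>_def by (rule markov_weights[OF a KA K A h Lh Lf P]) blast
    have eps: "0 < \<epsilon>" by (simp add: \<epsilon>_def add_pos_pos)
    \<comment> \<open>The remaining mass over \<open>x\<close> sees values at most
      \<open>m + s\<close>, the remaining mass over \<open>y\<close> values at least
      \<open>m\<close>; together it costs at most (1 - \<epsilon>) s.\<close>
    define m where "m = min (f y0) (f y1)"
    have le: "f z \<le> m + s" for z
      using f(1)[of z y0] f(1)[of z y1] by (auto simp: m_def min_def)
    have p01: "p0 = 1 - p1" "q0 = 1 - q1" using w by simp_all
    have "(p1 - \<epsilon>) * f x1 + p0 * f x0 \<le> (p1 - \<epsilon>) * (m + s) + p0 * (m + s)"
      using w eps le by (intro add_mono mult_left_mono) auto
    hence 1: "f' x \<le> \<epsilon> * f x1 + (1 - \<epsilon>) * (m + s)"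
      unfolding w p01 by (simp add: algebra_simps)
    have "(q1 - \<epsilon>) * m + q0 * m \<le> (q1 - \<epsilon>) * f y1 + q0 * f y0"
      using w eps by (intro add_mono mult_left_mono) (auto simp: m_def)
    hence 2: "f' y \<ge> \<epsilon> * f y1 + (1 - \<epsilon>) * m"
      unfolding w p01 by (simp add: algebra_simps)
    have "f x1 - f y1 \<le> b + c * dist x1 y1 powr a"
      using f(2)[of x1 y1] by simp
    also have "\<dots> \<le> b + c * (\<theta> * dist x y) powr a"
      using P a c by (intro add_left_mono mult_left_mono powr_mono2) (auto simp: pairing_def)
    also have "\<dots> = b + c * \<theta> powr a * dist x y powr a"
      using theta by (simp add: powr_mult)
    finally have "\<epsilon> * (f x1 - f y1) \<le> \<epsilon> * (b + c * \<theta> powr a * dist x y powr a)"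
      using eps by (intro mult_left_mono) auto
    with 1 2 show ?thesis by (simp add: algebra_simps)
  qed
  show ?thesis
    using *[of x y] *[of y x] by (auto simp: abs_le_iff \<epsilon>_def dist_commute)
qed

text \<open>The invariant is a Hoelder constant at most R s together with an oscillation at most s.
  The oscillation need not fall in a single step, only after contracted pairs have been followed for
  a block of M steps; then s is multiplied by \<kappa>0. The sequences \<open>h\<close> and
  \<open>f\<close> are quantified inside, so that one C and one \<kappa> serve all normalizers in
  the cone.\<close>

lemma contraction:
  fixes A :: "'a \<Rightarrow> real"
  assumes a: "0 < a" and KA: "0 \<le> KA" and K: "0 \<le> K" and A: "holder_with a KA A"
  obtains C \<kappa> where "1 \<le> C" "0 < \<kappa>" "\<kappa> < 1"
    "\<And>h f H t. (\<And>n. log_holder_with a K (h n)) \<Longrightarrow> (\<And>n. transfer_op T A (h n) = h (Suc n)) \<Longrightarrow>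
      (\<And>n. transfer_op T A (\<lambda>z. f n z * h n z) = (\<lambda>z. f (Suc n) z * h (Suc n) z)) \<Longrightarrow>
      0 \<le> H \<Longrightarrow> holder_with a H (f 0) \<Longrightarrow> holder_with a (C * \<kappa> ^ t * H) (f t)"
proof -
  define \<epsilon> where "\<epsilon> = 1 / (1 + exp (KA + K))"
  define c where "c = \<theta> powr a"
  define B where "B = KA + 2 * K"
  \<comment> \<open>With this R the oscillation term satisfies B s \<le> \<epsilon> (1 - c) / 2 * R
    s: half of the gain in \<open>holder_step\<close> absorbs it, and the other half leaves the
    factor \<sigma>.\<close>
  define R where "R = 1 + 2 * B / (\<epsilon> * (1 - c))"
  define \<sigma> where "\<sigma> = 1 - \<epsilon> * (1 - c) / 2"
  have eps: "0 < \<epsilon>" "\<epsilon> < 1" by (simp_all add: \<epsilon>_def add_pos_pos)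
  have c: "0 < c" "c < 1"
    using theta a powr_less_mono2[of a \<theta> 1] by (auto simp: c_def)
  have B: "0 \<le> B" using KA K by (simp add: B_def)
  have ec: "0 < \<epsilon> * (1 - c)" "\<epsilon> * (1 - c) < 1"
    using eps c mult_strict_mono[of \<epsilon> 1 "1 - c" 1] by auto
  have R: "1 \<le> R" using ec B by (simp add: R_def)
  have sigma: "0 < \<sigma>" "\<sigma> < 1" using ec by (auto simp: \<sigma>_def)
  have "(\<lambda>n. c ^ n) \<longlonglongrightarrow> 0" using c by (intro LIMSEQ_realpow_zero) auto
  hence "\<forall>\<^sub>F n in sequentially. c ^ n < 1 / (2 * R)"
    using R by (intro order_tendstoD(2)) auto
  then obtain N where N: "c ^ Suc N < 1 / (2 * R)"
    by (metis eventually_sequentially le_Suc_eq order_refl)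
  define M where "M = Suc N"
  have M: "R * c ^ M \<le> 1 / 2" "M > 0"
    using N R by (auto simp: M_def field_simps)
  \<comment> \<open>M is large enough that R c^M \<le> 1/2: the part of weight \<epsilon>^M that
    follows M contracted pairs then contributes at most s / 2 instead of s, whence 1 - \<epsilon>^M
    / 2.\<close>
  define \<kappa>0 where "\<kappa>0 = max \<sigma> (1 - \<epsilon> ^ M / 2)"
  have epsM: "0 < \<epsilon> ^ M" "\<epsilon> ^ M \<le> 1" using eps by (auto simp: power_le_one)
  have k0: "0 < \<kappa>0" "\<kappa>0 < 1" using sigma epsM by (auto simp: \<kappa>0_def)
  define \<kappa> where "\<kappa> = \<kappa>0 powr (1 / real M)"
  have kappa: "0 < \<kappa>" "\<kappa> < 1"
    using k0 M(2) powr_less_mono2[of "1 / real M" \<kappa>0 1] by (auto simp: \<kappa>_def)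
  \<comment> \<open>An incomplete last block costs at most one factor \<kappa>0, which explains the
    final constant R / \<kappa>0.\<close>
  have k0_power: "\<kappa>0 ^ (t div M) \<le> \<kappa> ^ t / \<kappa>0" for t
  proof -
    have "real t / real M \<le> real (t div M) + 1"
    proof -
      have "real t = real (t div M) * real M + real (t mod M)"
        by (metis div_mult_mod_eq of_nat_add of_nat_mult)
      also have "\<dots> \<le> (real (t div M) + 1) * real M"
        using mod_less_divisor[OF M(2), of t] by (simp add: algebra_simps)
      finally show ?thesis using M(2) by (simp add: divide_simps)
    qed
    hence "\<kappa>0 powr (real (t div M) + 1) \<le> \<kappa>0 powr (real t / real M)"
      using k0 by (intro powr_mono') auto
    moreover have "\<kappa>0 powr (real (t div M) + 1) = \<kappa>0 ^ (t div M) * \<kappa>0"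
      using k0 by (simp add: powr_add powr_realpow)
    moreover have "\<kappa>0 powr (real t / real M) = \<kappa> ^ t"
      using k0 by (simp add: \<kappa>_def powr_powr flip: powr_realpow)
    ultimately show ?thesis using k0 by (simp add: field_simps)
  qed
  have main: "holder_with a (R / \<kappa>0 * \<kappa> ^ t * H) (f t)"
    if h: "\<And>n. log_holder_with a K (h n)" "\<And>n. transfer_op T A (h n) = h (Suc n)"
      and f: "\<And>n. transfer_op T A (\<lambda>z. f n z * h n z) = (\<lambda>z. f (Suc n) z * h (Suc n) z)"
      and H: "0 \<le> H" and f0: "holder_with a H (f 0)" for h f H t
  proof -
    define Q where "Q s n \<longleftrightarrow> holder_with a (R * s) (f n) \<and> (\<forall>x y. \<bar>f n x - f n y\<bar> \<le> s)" for s n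
    have step: "Q s (Suc n)" "holder_with a (\<sigma> * (R * s)) (f (Suc n))" if "Q s n" "0 \<le> s" for s n
    proof -
      have osc: "\<bar>f n x - f n y\<bar> \<le> s" and hol: "holder_with a (R * s) (f n)" for x y
        using that by (auto simp: Q_def)
      have "holder_with a ((1 - (1 - c) * \<epsilon>) * (R * s) + B * s) (f (Suc n))"
        using holder_step[OF a KA K A h(1) h(1) h(2) f hol _ osc] that(2) R
        by (simp add: \<epsilon>_def c_def B_def)
      moreover have "(1 - (1 - c) * \<epsilon>) * (R * s) + B * s \<le> \<sigma> * (R * s)"
      proof -
        have "B \<le> \<epsilon> * (1 - c) / 2 * R"
          using ec eps c by (simp add: R_def distrib_left)
        hence "B * s \<le> \<epsilon> * (1 - c) / 2 * R * s"
          using that(2) by (rule mult_right_mono)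
        thus ?thesis by (simp add: \<sigma>_def field_simps)
      qed
      moreover have "0 \<le> (1 - (1 - c) * \<epsilon>) * (R * s) + B * s"
        using ec R B that(2) by (simp add: mult.commute)
      ultimately show hol': "holder_with a (\<sigma> * (R * s)) (f (Suc n))"
        by (intro holder_with_mono[where H' = "\<sigma> * (R * s)"]) auto
      have "\<bar>f (Suc n) x - f (Suc n) y\<bar> \<le> s" for x y
        using osc_step[OF a KA K A h(1) h(1) h(2) f osc, of s 0 x y] osc
        by (simp add: algebra_simps flip: \<epsilon>_def)
      moreover have "holder_with a (R * s) (f (Suc n))"
        by (rule holder_with_mono[OF hol' order_refl]) (use sigma R that(2) in \<open>auto intro: mult_left_le_one_le\<close>)
      ultimately show "Q s (Suc n)" by (simp add: Q_def)
    qed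
    have steps: "Q s (n + k)" if "Q s n" "0 \<le> s" for s n k
      using that by (induction k) (auto intro: step)
    \<comment> \<open>Unrolling \<open>osc_step\<close>: with weight \<epsilon>^k the two points
      have followed k contracted pairs; the complementary weight is charged
      \<open>s\<close>.\<close>
    have osc: "\<bar>f (n + k) x - f (n + k) y\<bar> \<le> s * (1 - \<epsilon> ^ k) + s * \<epsilon> ^ k * R * c ^ k * dist x y powr a"
      if "Q s n" "0 \<le> s" for s n k x y
    proof (induction k arbitrary: x y)
      case 0
      show ?case using that by (auto simp: Q_def holder_with_def mult_ac)
    next
      case (Suc k)
      have osc: "\<bar>f (n + k) x - f (n + k) y\<bar> \<le> s" for x y
        using steps[OF that, of k] by (auto simp: Q_def)
      have "0 \<le> s * \<epsilon> ^ k * R * c ^ k"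
        using that eps c R by auto
      from osc_step[OF a KA K A h(1) h(1) h(2) f osc Suc.IH this, of x y, folded \<epsilon>_def c_def]
      show ?case
        by (simp add: algebra_simps)
    qed
    have block: "Q (\<kappa>0 * s) (n + M)" if "Q s n" "0 \<le> s" for s n
    proof -
      have "\<bar>f (n + M) x - f (n + M) y\<bar> \<le> \<kappa>0 * s" for x y
      proof -
        have "\<bar>f (n + M) x - f (n + M) y\<bar> \<le> s * (1 - \<epsilon> ^ M) + s * \<epsilon> ^ M * (R * c ^ M) * dist x y powr a"
          using osc[OF that, of M x y] by (simp add: mult_ac)
        also have "\<dots> \<le> s * (1 - \<epsilon> ^ M) + s * \<epsilon> ^ M * (1 / 2) * 1"
        proof -
          have "(R * c ^ M) * dist x y powr a \<le> 1 / 2 * 1"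
            using M(1) a by (intro mult_mono dist_powr_le_1) auto
          hence "s * \<epsilon> ^ M * ((R * c ^ M) * dist x y powr a) \<le> s * \<epsilon> ^ M * (1 / 2 * 1)"
            by (rule mult_left_mono) (use that epsM in simp)
          thus ?thesis by (simp only: mult.assoc add_left_mono)
        qed
        also have "\<dots> = (1 - \<epsilon> ^ M / 2) * s" by (simp add: algebra_simps)
        also have "\<dots> \<le> \<kappa>0 * s" using that(2) by (intro mult_right_mono) (auto simp: \<kappa>0_def)
        finally show ?thesis .
      qed
      \<comment> \<open>The last step of the block already yields \<sigma> R s, and \<sigma> \<le>
        \<kappa>0, so both halves of \<open>Q\<close> shrink by the same factor.\<close>
      moreover have "holder_with a (\<sigma> * (R * s)) (f (n + M))"
        using step(2)[OF steps[OF that, of N] that(2)] by (simp add: M_def)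
      hence "holder_with a (R * (\<kappa>0 * s)) (f (n + M))"
      proof (rule holder_with_mono)
        have "\<sigma> * (R * s) \<le> \<kappa>0 * (R * s)"
          using R that(2) by (intro mult_right_mono) (auto simp: \<kappa>0_def)
        thus "\<sigma> * (R * s) \<le> R * (\<kappa>0 * s)" by (simp add: mult_ac)
      qed (use sigma R that(2) in auto)
      ultimately show ?thesis by (simp add: Q_def)
    qed
    have Q0: "Q H 0"
    proof -
      have "H \<le> R * H" using mult_right_mono[OF R H] by simp
      hence "holder_with a (R * H) (f 0)" using H by (rule holder_with_mono[OF f0 order_refl])
      thus ?thesis using holder_with_osc[OF f0] a H by (simp add: Q_def)
    qed
    have Qm: "Q (\<kappa>0 ^ m * H) (m * M)" for m
    proof (induction m)
      case (Suc m)
      show ?case using block[OF Suc.IH] k0 H by (simp add: mult.assoc add.commute)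
    qed (use Q0 in simp)
    have "Q (\<kappa>0 ^ (t div M) * H) t"
      using steps[OF Qm[of "t div M"], of "t mod M"] k0 H by simp
    hence "holder_with a (R * (\<kappa>0 ^ (t div M) * H)) (f t)" by (simp add: Q_def)
    moreover have "R * (\<kappa>0 ^ (t div M) * H) \<le> R * (\<kappa> ^ t / \<kappa>0 * H)"
      using R H by (intro mult_left_mono mult_right_mono k0_power) auto
    ultimately show ?thesis
      using R H k0 by (auto elim!: holder_with_mono)
  qed
  have "1 \<le> R / \<kappa>0" using R k0 by simp
  show ?thesis
  proof (rule that[OF \<open>1 \<le> R / \<kappa>0\<close> kappa])
    fix h f H t
    assume "\<And>n. log_holder_with a K (h n)" "\<And>n. transfer_op T A (h n) = h (Suc n)"
      "\<And>n. transfer_op T A (\<lambda>z. f n z * h n z) = (\<lambda>z. f (Suc n) z * h (Suc n) z)"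
      "0 \<le> H" "holder_with a H (f 0)"
    thus "holder_with a (R / \<kappa>0 * \<kappa> ^ t * H) (f t)" by (rule main)
  qed
qed

end

section \<open>Hoelder spaces and measures on the circle\<close>

lemma dist_circle_of_le: "dist (circle_of r) (circle_of s) \<le> \<bar>r - s\<bar>"
proof -
  define k where "k = \<lfloor>r\<rfloor> - \<lfloor>s\<rfloor>"
  have eq: "r - s = frac r - frac s + of_int k" by (simp add: frac_def k_def)
  have fr: "0 \<le> frac r" "frac r < 1" "0 \<le> frac s" "frac s < 1" by (simp_all add: frac_lt_1)
  show ?thesis
  proof (cases "k = 0")
    case True
    thus ?thesis using eq by (simp add: dist_circle_def)
  next
    case False
    hence "1 \<le> \<bar>real_of_int k\<bar>" by linarith
    hence "1 - \<bar>frac r - frac s\<bar> \<le> \<bar>r - s\<bar>" using eq by linarith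
    thus ?thesis by (simp add: dist_circle_def)
  qed
qed

lemma dist_circle_le_half: "dist (x::circle) y \<le> 1 / 2"
  by (simp add: dist_circle_def min_def)

lemma continuous_on_circle_of: "continuous_on UNIV circle_of"
proof (rule lipschitz_on_continuous_on)
  show "1-lipschitz_on UNIV circle_of"
    by (rule lipschitz_onI) (simp_all add: dist_circle_of_le dist_real_def)
qed

lemma circle_of_measurable [measurable]: "circle_of \<in> borel_measurable borel"
  by (rule borel_measurable_continuous_onI) (rule continuous_on_circle_of)

lemma compact_UNIV_circle: "compact (UNIV :: circle set)"
proof -
  have "x \<in> circle_of ` {0..1}" for x
    using coord[of x] by (intro image_eqI[of _ _ "coord x"]) auto
  hence "UNIV = circle_of ` {0..1}" by blast
  moreover have "compact (circle_of ` {0..1})"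
    by (rule compact_continuous_image) (auto intro: continuous_on_subset[OF continuous_on_circle_of])
  ultimately show ?thesis by simp
qed

lemma holder_spaceE:
  assumes "f \<in> holder_space a"
  obtains H where "0 \<le> H" "holder_with a H f"
proof -
  obtain C where C: "\<And>x y. \<bar>f x - f y\<bar> \<le> C * dist x y powr a"
    using assms by (auto simp: holder_space_def)
  have "C * dist x y powr a \<le> \<bar>C\<bar> * dist x y powr a" for x y
    by (intro mult_right_mono) auto
  hence "holder_with a \<bar>C\<bar> f"
    using C order_trans unfolding holder_with_def by blast
  thus ?thesis using that[of "\<bar>C\<bar>"] by simp
qed

lemma holder_spaceI: "holder_with a H f \<Longrightarrow> f \<in> holder_space a"
  by (auto simp: holder_with_def holder_space_def)

lemma ex_circle_neq: "\<exists>x y :: circle. x \<noteq> y"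
proof -
  have "coord (circle_of 0) \<noteq> coord (circle_of (1/2))" by (simp add: frac_eq)
  thus ?thesis by metis
qed

lemma holder_const_eq:
  "holder_const a f = Inf {C. holder_with a C f}"
  by (simp add: holder_const_def holder_with_def)

lemma holder_with_nonneg:
  fixes f :: "circle \<Rightarrow> real"
  assumes "holder_with a C f"
  shows "0 \<le> C"
proof -
  obtain x y :: circle where xy: "x \<noteq> y" using ex_circle_neq by blast
  have "0 \<le> C * dist x y powr a" using holder_withD[OF assms, of x y] by linarith
  thus ?thesis using xy by (simp add: zero_le_mult_iff)
qed

lemma holder_const_le:
  assumes "holder_with a C f"
  shows "holder_const a f \<le> C"
  unfolding holder_const_eq
  by (rule cInf_lower) (use assms holder_with_nonneg in \<open>auto intro!: bdd_belowI[of _ 0]\<close>)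

text \<open>The infimum is attained: every admissible constant dominates each difference quotient,
  hence so does their infimum.\<close>

lemma
  assumes "f \<in> holder_space a"
  shows holder_with_holder_const: "holder_with a (holder_const a f) f"
    and holder_const_nonneg: "0 \<le> holder_const a f"
proof -
  obtain H where H: "holder_with a H f" using assms by (rule holder_spaceE)
  show "holder_with a (holder_const a f) f"
    unfolding holder_with_def
  proof (intro allI)
    fix x y
    show "\<bar>f x - f y\<bar> \<le> holder_const a f * dist x y powr a"
    proof (cases "x = y")
      case False
      hence "\<bar>f x - f y\<bar> / dist x y powr a \<le> holder_const a f"
        unfolding holder_const_eq using H
        by (intro cInf_greatest) (auto simp: holder_with_def field_simps)
      thus ?thesis using False by (simp add: field_simps)
    qed simp
  qed
  thus "0 \<le> holder_const a f" by (rule holder_with_nonneg)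
qed

lemma holder_normI:
  assumes f: "holder_with a H f" "\<And>x. \<bar>f x\<bar> \<le> M"
  shows "holder_norm a f \<le> M + H"
  unfolding holder_norm_def
  by (intro add_mono cSUP_least holder_const_le f) auto

lemma
  assumes f: "f \<in> holder_space a" and a: "0 < a"
  shows abs_le_holder_norm: "\<bar>f x\<bar> \<le> holder_norm a f"
    and holder_const_le_norm: "holder_const a f \<le> holder_norm a f"
proof -
  have cont: "continuous_on UNIV (\<lambda>x. \<bar>f x\<bar>)"
    by (intro continuous_intros holder_with_imp_continuous[OF holder_with_holder_const[OF f] a])
  have "bdd_above (range (\<lambda>x. \<bar>f x\<bar>))"
    using compact_continuous_image[OF cont compact_UNIV_circle]
    by (intro bounded_imp_bdd_above compact_imp_bounded)
  hence "\<bar>f y\<bar> \<le> (SUP x. \<bar>f x\<bar>)" for y by (rule cSUP_upper2[of _ _ y]) auto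
  from this[of x] show "\<bar>f x\<bar> \<le> holder_norm a f" "holder_const a f \<le> holder_norm a f"
    using holder_const_nonneg[OF f] by (auto simp: holder_norm_def)
qed

lemma continuous_circle_bounded:
  fixes f :: "circle \<Rightarrow> real"
  assumes "continuous_on UNIV f"
  shows "\<exists>B. \<forall>x. \<bar>f x\<bar> \<le> B"
  using compact_imp_bounded[OF compact_continuous_image[OF assms compact_UNIV_circle]]
  by (auto simp: bounded_iff)

text \<open>Compactness is borrowed from the real line: push the atomic measures forward by
  \<open>coord\<close>, extract a weak limit there and push it back by \<open>circle_of\<close>. The
  jump of \<open>coord\<close> at 0 does no harm, since only the continuous periodic functions
  f(circle_of x) are integrated, and an atom of the limit at 1 is folded onto 0.\<close>

lemma circle_weak_limit:
  fixes S :: "nat \<Rightarrow> circle set" and w :: "nat \<Rightarrow> circle \<Rightarrow> real"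
  assumes S: "\<And>n. finite (S n)" and w: "\<And>n y. y \<in> S n \<Longrightarrow> 0 \<le> w n y" "\<And>n. (\<Sum>y\<in>S n. w n y) = 1"
  shows "\<exists>\<nu> r. prob_space \<nu> \<and> sets \<nu> = sets borel \<and> strict_mono r \<and>
    (\<forall>f. continuous_on UNIV f \<longrightarrow> (\<lambda>k. \<Sum>y\<in>S (r k). w (r k) y * f y) \<longlonglongrightarrow> (\<integral>x. f x \<partial>\<nu>))"
proof -
  define N where "N n = point_measure (S n) (\<lambda>y. ennreal (w n y))" for n
  define M where "M n = distr (N n) borel coord" for n
  have space: "space (N n) = S n" "sets (N n) = Pow (S n)" for n
    by (simp_all add: N_def space_point_measure sets_point_measure)
  have meas [measurable]: "g \<in> borel_measurable (N n)" for g :: "circle \<Rightarrow> real" and n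
    by (simp add: measurable_def space)
  have probN: "prob_space (N n)" for n
    unfolding N_def using S w by (intro prob_space_point_measure) auto
  have probM: "prob_space (M n)" for n
    unfolding M_def by (rule prob_space.prob_space_distr[OF probN]) measurable
  have distM: "real_distribution (M n)" for n
    using probM by (auto simp: real_distribution_def real_distribution_axioms_def M_def)
  \<comment> \<open>All the measures live on [0,1); tightness is stated with intervals open on the
    left, so the left endpoint lies below 0.\<close>
  have "measure (M n) {-1<..1} = 1" for n
  proof -
    interpret N: prob_space "N n" by (rule probN)
    have "coord -` {-1<..1} \<inter> space (N n) = space (N n)"
      using coord by (auto simp: less_imp_le less_le_trans[of "-1" 0])
    thus ?thesis by (simp add: M_def measure_distr N.prob_space)
  qed
  hence "\<exists>a b. a < b \<and> (\<forall>n. 1 - e < measure (M n) {a<..b})" if "0 < e" for e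
    using that by (intro exI[of _ "-1"] exI[of _ 1]) simp
  hence "tight M"
    unfolding tight_def using distM by blast
  from tight_imp_convergent_subsubsequence[OF this strict_mono_id]
  obtain r L where r: "strict_mono r" and L: "real_distribution L" and conv: "weak_conv_m (M \<circ> r) L"
    by (auto simp: comp_def)
  interpret L: real_distribution L by (rule L)
  define \<nu> where "\<nu> = distr L borel circle_of"
  show ?thesis
  proof (intro exI[of _ \<nu>] exI[of _ r] conjI allI impI)
    show "prob_space \<nu>"
      unfolding \<nu>_def by (rule L.prob_space_distr) simp
    show "sets \<nu> = sets borel" by (simp add: \<nu>_def)
    fix f :: "circle \<Rightarrow> real" assume f: "continuous_on UNIV f"
    then obtain B where B: "\<And>x. \<bar>f x\<bar> \<le> B" using continuous_circle_bounded by blast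
    have f_meas: "f \<in> borel_measurable borel"
      using f by (rule borel_measurable_continuous_onI)
    have "continuous_on UNIV (\<lambda>x. f (circle_of x))"
      by (rule continuous_on_compose2[OF f continuous_on_circle_of]) auto
    hence cont: "isCont (\<lambda>x. f (circle_of x)) x" for x
      by (auto simp: continuous_on_eq_continuous_at)
    have "(\<lambda>k. integral\<^sup>L ((M \<circ> r) k) (\<lambda>x. f (circle_of x))) \<longlonglongrightarrow> integral\<^sup>L L (\<lambda>x. f (circle_of x))"
      by (rule weak_conv_imp_integral_bdd_continuous_conv[OF _ L conv cont]) (use distM B in auto)
    moreover have "integral\<^sup>L L (\<lambda>x. f (circle_of x)) = (\<integral>x. f x \<partial>\<nu>)"
      unfolding \<nu>_def by (rule integral_distr[symmetric]) (use f_meas in auto)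
    moreover have "integral\<^sup>L (M n) (\<lambda>x. f (circle_of x)) = (\<Sum>y\<in>S n. w n y * f y)" for n
    proof -
      have "integral\<^sup>L (M n) (\<lambda>x. f (circle_of x)) = integral\<^sup>L (N n) f"
        unfolding M_def by (subst integral_distr) (use f_meas in auto)
      also have "\<dots> = (\<Sum>y\<in>S n. w n y * f y)"
        unfolding N_def using S w by (subst lebesgue_integral_point_measure_finite) auto
      finally show ?thesis .
    qed
    ultimately show "(\<lambda>k. \<Sum>y\<in>S (r k). w (r k) y * f y) \<longlonglongrightarrow> (\<integral>x. f x \<partial>\<nu>)"
      by (simp add: comp_def)
  qed (rule r)
qed

section \<open>The eigendata and the spectral gap\<close>

lemma transfer_op_add: "transfer_op T A (\<lambda>x. f x + g x) = (\<lambda>x. transfer_op T A f x + transfer_op T A g x)"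
  by (auto simp: transfer_op_def sum.distrib algebra_simps)

lemma transfer_op_cmult: "transfer_op T A (\<lambda>x. c * f x) = (\<lambda>x. c * transfer_op T A f x)"
  by (auto simp: transfer_op_def sum_distrib_left algebra_simps)

lemma transfer_op_mono: "(\<And>z. f z \<le> g z) \<Longrightarrow> transfer_op T A f x \<le> transfer_op T A g x"
  unfolding transfer_op_def by (intro sum_mono mult_left_mono) auto

lemma transfer_op_tendsto:
  assumes "\<And>z. (\<lambda>n. f n z) \<longlonglongrightarrow> g z"
  shows "(\<lambda>n. transfer_op T A (f n) x) \<longlonglongrightarrow> transfer_op T A g x"
  unfolding transfer_op_def by (intro tendsto_sum tendsto_mult_left assms)

text \<open>Evaluation of the n-th iterate at a point is a finite nonnegative atomic measure that
  does not depend on \<open>f\<close>; limits of such functionals can then be represented by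
  measures.\<close>

lemma funpow_transfer_op_eq_sum:
  assumes fin: "\<And>x. finite {z. T z = x}"
  shows "\<exists>S w. finite S \<and> (\<forall>y. 0 \<le> w y) \<and>
           (\<forall>f. (transfer_op T A ^^ n) f x = (\<Sum>y\<in>S. w y * f y))"
proof (induction n)
  case 0
  show ?case by (intro exI[of _ "{x}"] exI[of _ "\<lambda>_. 1"]) auto
next
  case (Suc n)
  then obtain S w where S: "finite S" and w: "\<And>y. 0 \<le> w y"
    and eq: "\<And>f. (transfer_op T A ^^ n) f x = (\<Sum>y\<in>S. w y * f y)" by blast
  define S' where "S' = T -` S"
  have "S' = (\<Union>y\<in>S. {z. T z = y})" by (auto simp: S'_def)
  hence fin': "finite S'" using S fin by simp
  have "(transfer_op T A ^^ Suc n) f x = (\<Sum>z\<in>S'. w (T z) * exp (A z) * f z)" for f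
  proof -
    have "(transfer_op T A ^^ Suc n) f x = (\<Sum>y\<in>S. w y * transfer_op T A f y)"
      by (simp add: funpow_Suc_right eq del: funpow.simps)
    also have "\<dots> = (\<Sum>y\<in>S. \<Sum>z\<in>{z \<in> S'. T z = y}. w (T z) * exp (A z) * f z)"
    proof (rule sum.cong[OF refl])
      fix y assume "y \<in> S"
      hence "{z. T z = y} = {z \<in> S'. T z = y}" by (auto simp: S'_def)
      thus "w y * transfer_op T A f y = (\<Sum>z\<in>{z \<in> S'. T z = y}. w (T z) * exp (A z) * f z)"
        by (simp add: transfer_op_def sum_distrib_left mult.assoc)
    qed
    also have "\<dots> = (\<Sum>z\<in>S'. w (T z) * exp (A z) * f z)"
      by (rule sum.group[OF fin' S]) (auto simp: S'_def)
    finally show ?thesis .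
  qed
  thus ?case using fin' w by (intro exI[of _ S'] exI[of _ "\<lambda>z. w (T z) * exp (A z)"]) auto
qed

lemma integrable_circle_continuous:
  fixes f :: "circle \<Rightarrow> real"
  assumes "finite_measure \<nu>" "sets \<nu> = sets borel" "continuous_on UNIV f"
  shows "integrable \<nu> f"
proof -
  obtain B where "\<And>x. \<bar>f x\<bar> \<le> B" using continuous_circle_bounded[OF assms(3)] by blast
  moreover have "f \<in> borel_measurable \<nu>"
    using borel_measurable_continuous_onI[OF assms(3)] measurable_cong_sets[OF assms(2) refl] by blast
  ultimately show ?thesis
    using assms(1) by (intro finite_measure.integrable_const_bound[where B = B]) auto
qed

context paired_map
begin

lemma finite_preimage: "finite {z. T z = x}"
  using ex_pairing[of x x] by (auto simp: pairing_def)

lemma transfer_op_pos: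
  assumes "\<And>z. 0 < f z"
  shows "0 < transfer_op T A f x"
proof -
  obtain x0 x1 y0 y1 where P: "pairing T \<theta> x x x0 x1 y0 y1" using ex_pairing by blast
  show ?thesis
    unfolding transfer_op_pairing[OF P] using assms by (simp add: add_pos_pos)
qed

lemma transfer_op_holder_with:
  fixes f :: "'a \<Rightarrow> real"
  assumes g: "holder_with a H (\<lambda>z. exp (A z) * f z)" and "0 \<le> a" "0 \<le> H"
  shows "holder_with a (2 * H) (transfer_op T A f)"
  unfolding holder_with_def
proof (intro allI)
  fix x y
  obtain x0 x1 y0 y1 where P: "pairing T \<theta> x y x0 x1 y0 y1" using ex_pairing by blast
  have 1: "\<bar>exp (A z) * f z - exp (A w) * f w\<bar> \<le> H * dist x y powr a" if "dist z w \<le> dist x y" for z w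
  proof -
    have "\<bar>exp (A z) * f z - exp (A w) * f w\<bar> \<le> H * dist z w powr a" by (rule holder_withD[OF g])
    also have "\<dots> \<le> H * dist x y powr a"
      using assms that by (intro mult_left_mono powr_mono2) auto
    finally show ?thesis .
  qed
  have "dist x0 y0 \<le> dist x y" "dist x1 y1 \<le> \<theta> * dist x y"
    using P by (auto simp: pairing_def)
  moreover from this have "dist x1 y1 \<le> dist x y"
    using theta mult_right_mono[of \<theta> 1 "dist x y"] by simp
  ultimately show "\<bar>transfer_op T A f x - transfer_op T A f y\<bar> \<le> 2 * H * dist x y powr a"
    unfolding transfer_op_pairing[OF P] using 1[of x0 y0] 1[of x1 y1] by linarith
qed

end

text \<open>\<open>KA\<close> is the Hoelder constant of A, while \<open>K\<close> is both the
  flatness constant and the opening of the cone. By \<open>flat\<close>, A varies along a matched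
  pair by at most the amount by which K d^\<alpha> drops from the two points to their
  preimages.\<close>

locale flat_potential = paired_map T \<theta> for T :: "circle \<Rightarrow> circle" and \<theta> +
  fixes A :: "circle \<Rightarrow> real" and \<alpha> KA K :: real
  assumes alpha: "0 < \<alpha>" and KA: "0 \<le> KA" and K: "0 \<le> K" and A: "holder_with \<alpha> KA A"
    and flat: "\<exists>x0 x1 y0 y1. pairing T \<theta> x y x0 x1 y0 y1 \<and>
      \<bar>A x0 - A y0\<bar> \<le> K * (dist x y powr \<alpha> - dist x0 y0 powr \<alpha>) \<and>
      \<bar>A x1 - A y1\<bar> \<le> K * (dist x y powr \<alpha> - dist x1 y1 powr \<alpha>)"
begin

section \<open>The invariant cone, the eigenmeasure and the eigenfunction\<close>

abbreviation L :: "(circle \<Rightarrow> real) \<Rightarrow> circle \<Rightarrow> real"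
  where "L \<equiv> transfer_op T A"

definition iter_one :: "nat \<Rightarrow> circle \<Rightarrow> real"
  where "iter_one n = (L ^^ n) (\<lambda>_. 1)"

text \<open>Along a matched pair z, w the potential costs K (d(x,y)^\<alpha> - d(z,w)^\<alpha>) and
  \<open>h\<close> costs K d(z,w)^\<alpha>. The terms in d(z,w) cancel, so both summands, and hence
  their sum, keep the constant K.\<close>

lemma L_log_holder:
  assumes h: "log_holder_with \<alpha> K h"
  shows "log_holder_with \<alpha> K (L h)"
  unfolding log_holder_with_def
proof (intro conjI allI)
  show "0 < L h x" for x
    using log_holder_withD(1)[OF h] by (rule transfer_op_pos)
  fix x y
  obtain x0 x1 y0 y1 where P: "pairing T \<theta> x y x0 x1 y0 y1"
    and "\<bar>A x0 - A y0\<bar> \<le> K * (dist x y powr \<alpha> - dist x0 y0 powr \<alpha>)"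
      "\<bar>A x1 - A y1\<bar> \<le> K * (dist x y powr \<alpha> - dist x1 y1 powr \<alpha>)"
    using flat[of x y] by blast
  moreover have "exp (A z) * h z \<le> exp (K * dist x y powr \<alpha>) * (exp (A w) * h w)"
    if "\<bar>A z - A w\<bar> \<le> K * (dist x y powr \<alpha> - dist z w powr \<alpha>)" for z w
  proof -
    have "exp (A z) * h z \<le> exp (K * (dist x y powr \<alpha> - dist z w powr \<alpha>) + A w) *
        (exp (K * dist z w powr \<alpha>) * h w)"
      using that log_holder_withD[OF h] by (intro mult_mono) (auto simp: less_imp_le)
    also have "\<dots> = exp (K * dist x y powr \<alpha>) * (exp (A w) * h w)"
      by (simp add: algebra_simps flip: exp_add)
    finally show ?thesis .
  qed
  ultimately show "L h x \<le> exp (K * dist x y powr \<alpha>) * L h y"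
    unfolding transfer_op_pairing[OF P] by (simp add: add_mono distrib_left)
qed

text \<open>Bounded distortion, uniform in \<open>n\<close>: it makes these functions admissible
  normalizers and later gives two-sided bounds on their size.\<close>

lemma iter_one_log_holder: "log_holder_with \<alpha> K (iter_one n)"
proof (induction n)
  case 0
  show ?case using K by (simp add: iter_one_def log_holder_with_def)
next
  case (Suc n)
  thus ?case by (auto simp: iter_one_def dest: L_log_holder)
qed

lemma iter_one_pos: "0 < iter_one n x"
  using iter_one_log_holder by (rule log_holder_withD(1))

lemma iter_one_Suc: "L (iter_one n) = iter_one (Suc n)"
  by (simp add: iter_one_def)

lemma exp_A_holder:
  obtains M G where "0 \<le> M" "0 \<le> G" "\<And>z. exp (A z) \<le> M" "holder_with \<alpha> G (\<lambda>z. exp (A z))"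
proof -
  have log: "log_holder_with \<alpha> KA (\<lambda>z. exp (A z))"
    unfolding log_holder_with_def
  proof (intro conjI allI)
    show "exp (A x) \<le> exp (KA * dist x y powr \<alpha>) * exp (A y)" for x y
      using holder_withD[OF A, of x y] by (simp flip: exp_add)
  qed simp
  fix x :: circle
  define M where "M = exp KA * exp (A x)"
  have M: "exp (A z) \<le> M" for z
    unfolding M_def by (rule log_holder_with_le[OF log]) (use alpha KA in auto)
  show ?thesis
  proof (rule that)
    show "0 \<le> M" "0 \<le> KA * M" using KA by (auto simp: M_def)
    show "holder_with \<alpha> (KA * M) (\<lambda>z. exp (A z))"
      by (rule log_holder_with_imp_holder_with[OF log KA M])
  qed (rule M)
qed

lemma L_holder_norm:
  obtains C where "\<And>f. f \<in> holder_space \<alpha> \<Longrightarrow> L f \<in> holder_space \<alpha>"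
    "\<And>f. f \<in> holder_space \<alpha> \<Longrightarrow> holder_norm \<alpha> (L f) \<le> C * holder_norm \<alpha> f"
proof -
  obtain M G where M: "0 \<le> M" "\<And>z. exp (A z) \<le> M" and G: "0 \<le> G" "holder_with \<alpha> G (\<lambda>z. exp (A z))"
    using exp_A_holder by metis
  have *: "L f \<in> holder_space \<alpha> \<and> holder_norm \<alpha> (L f) \<le> (4 * M + 2 * G) * holder_norm \<alpha> f"
    if f: "f \<in> holder_space \<alpha>" for f
  proof -
    define N where "N = holder_norm \<alpha> f"
    have N: "\<bar>f x\<bar> \<le> N" "holder_const \<alpha> f \<le> N" "0 \<le> N" for x
      using abs_le_holder_norm[OF f alpha] holder_const_le_norm[OF f alpha] holder_const_nonneg[OF f]
      by (auto simp: N_def)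
    have "holder_with \<alpha> N f"
      by (rule holder_with_mono[OF holder_with_holder_const[OF f] order_refl])
         (use N holder_const_nonneg[OF f] in auto)
    hence "holder_with \<alpha> (M * N + N * G) (\<lambda>z. exp (A z) * f z)"
      using M G N by (intro holder_with_mult) auto
    hence hol: "holder_with \<alpha> (2 * (M * N + N * G)) (L f)"
      by (rule transfer_op_holder_with) (use M G N alpha in auto)
    have "\<bar>L f x\<bar> \<le> 2 * M * N" for x
    proof -
      obtain x0 x1 y0 y1 where P: "pairing T \<theta> x x x0 x1 y0 y1" using ex_pairing by blast
      have "\<bar>exp (A z) * f z\<bar> \<le> M * N" for z
        unfolding abs_mult using M N by (intro mult_mono) auto
      from this[of x0] this[of x1] show ?thesis
        unfolding transfer_op_pairing[OF P] by linarith
    qed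
    from holder_normI[OF hol this]
    have "holder_norm \<alpha> (L f) \<le> (4 * M + 2 * G) * N" by (simp add: algebra_simps)
    with holder_spaceI[OF hol] show ?thesis by (simp add: N_def)
  qed
  show ?thesis by (rule that) (use * in auto)
qed

lemma L_acts_continuously: "acts_continuously_on (holder_space \<alpha>) (holder_norm \<alpha>) L"
proof -
  obtain C where "\<And>f. f \<in> holder_space \<alpha> \<Longrightarrow> L f \<in> holder_space \<alpha>"
    "\<And>f. f \<in> holder_space \<alpha> \<Longrightarrow> holder_norm \<alpha> (L f) \<le> C * holder_norm \<alpha> f"
    using L_holder_norm by blast
  thus ?thesis
    unfolding acts_continuously_on_def by (auto simp: transfer_op_add transfer_op_cmult)
qed

lemma L_holder_space: "f \<in> holder_space \<alpha> \<Longrightarrow> L f \<in> holder_space \<alpha>"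
  using L_acts_continuously by (simp add: acts_continuously_on_def)

text \<open>By positivity of L, bounds by multiples of L^n 1 persist, so the ranges of the ratios
  L^n f / L^n 1 are nested.\<close>

lemma ratio_bounds:
  assumes "\<And>z. l * iter_one n z \<le> (L ^^ n) f z" "\<And>z. (L ^^ n) f z \<le> u * iter_one n z"
  shows "l * iter_one (n + m) x \<le> (L ^^ (n + m)) f x \<and> (L ^^ (n + m)) f x \<le> u * iter_one (n + m) x"
proof (induction m arbitrary: x)
  case (Suc m)
  have "l * iter_one (n + Suc m) x = L (\<lambda>z. l * iter_one (n + m) z) x" for l x
    by (simp add: transfer_op_cmult iter_one_Suc)
  moreover have "(L ^^ (n + Suc m)) f x = L ((L ^^ (n + m)) f) x" by simp
  ultimately show ?case using Suc.IH by (auto intro!: transfer_op_mono)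
qed (use assms in auto)

text \<open>The ratios L^n f / L^n 1 have Hoelder constants tending to 0 and nested ranges, so they
  converge to a constant. At a fixed point each ratio is the integral of \<open>f\<close> against an
  atomic probability measure; a weak limit of these measures is \<nu>.\<close>

lemma conformal_measure:
  obtains C \<kappa> \<nu> where "1 \<le> C" "0 < \<kappa>" "\<kappa> < 1" "prob_space \<nu>" "sets \<nu> = sets borel"
    "\<And>f H n. holder_with \<alpha> H f \<Longrightarrow> holder_with \<alpha> (C * \<kappa> ^ n * H) (\<lambda>x. (L ^^ n) f x / iter_one n x)"
    "\<And>f H n x. holder_with \<alpha> H f \<Longrightarrow> \<bar>(L ^^ n) f x / iter_one n x - (\<integral>x. f x \<partial>\<nu>)\<bar> \<le> C * \<kappa> ^ n * H"
proof (rule contraction[OF alpha KA K A])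
  fix C \<kappa> :: real
  assume C: "1 \<le> C" "0 < \<kappa>" "\<kappa> < 1"
    and contr: "\<And>h f H t. (\<And>n. log_holder_with \<alpha> K (h n)) \<Longrightarrow> (\<And>n. L (h n) = h (Suc n)) \<Longrightarrow>
      (\<And>n. L (\<lambda>z. f n z * h n z) = (\<lambda>z. f (Suc n) z * h (Suc n) z)) \<Longrightarrow>
      0 \<le> H \<Longrightarrow> holder_with \<alpha> H (f 0) \<Longrightarrow> holder_with \<alpha> (C * \<kappa> ^ t * H) (f t)"
  have hol: "holder_with \<alpha> (C * \<kappa> ^ n * H) (\<lambda>x. (L ^^ n) f x / iter_one n x)"
    if f: "holder_with \<alpha> H f" for f H n
  proof (rule contr[where h = iter_one])
    show "L (\<lambda>z. (L ^^ n) f z / iter_one n z * iter_one n z)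
        = (\<lambda>z. (L ^^ Suc n) f z / iter_one (Suc n) z * iter_one (Suc n) z)" for n
      using iter_one_pos less_imp_neq[OF iter_one_pos] by (simp add: less_imp_neq[symmetric])
    show "holder_with \<alpha> H (\<lambda>x. (L ^^ 0) f x / iter_one 0 x)"
      using f by (simp add: iter_one_def)
  qed (use iter_one_log_holder iter_one_Suc holder_with_nonneg[OF f] in auto)
  have osc: "\<bar>(L ^^ n) f x / iter_one n x - (L ^^ (n + m)) f z / iter_one (n + m) z\<bar> \<le> C * \<kappa> ^ n * H"
    if f: "holder_with \<alpha> H f" for f H n m x z
  proof -
    define c where "c = C * \<kappa> ^ n * H"
    define v where "v = (L ^^ n) f x / iter_one n x"
    have c: "0 \<le> c" using holder_with_nonneg[OF hol[OF f]] by (simp add: c_def)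
    have near: "\<bar>(L ^^ n) f z / iter_one n z - v\<bar> \<le> c" for z
      unfolding v_def using holder_with_osc[OF hol[OF f, of n], of z x] alpha c by (simp add: c_def)
    have "(v - c) * iter_one n z \<le> (L ^^ n) f z" "(L ^^ n) f z \<le> (v + c) * iter_one n z" for z
      using near[of z] iter_one_pos[of n z] by (simp_all add: abs_le_iff field_simps)
    from ratio_bounds[OF this, of m z] show ?thesis
      unfolding v_def[symmetric] c_def[symmetric]
      using iter_one_pos[of "n + m" z] by (simp add: abs_le_iff field_simps)
  qed
  fix x0 :: circle
  obtain S w where S: "\<And>n. finite (S n)" and w: "\<And>n y. 0 \<le> w n y"
    and eq: "\<And>n f. (L ^^ n) f x0 = (\<Sum>y\<in>S n. w n y * f y)"
    using funpow_transfer_op_eq_sum[OF finite_preimage, where A = A and x = x0] by metis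
  define w' where "w' n y = w n y / iter_one n x0" for n y
  have eq': "(\<Sum>y\<in>S n. w' n y * f y) = (L ^^ n) f x0 / iter_one n x0" for n f
    by (simp add: w'_def eq sum_divide_distrib)
  have "(\<Sum>y\<in>S n. w' n y) = 1" for n
    using eq'[of n "\<lambda>_. 1"] iter_one_pos[of n x0] by (simp add: iter_one_def)
  moreover have "0 \<le> w' n y" for n y
    using w iter_one_pos[of n x0] by (simp add: w'_def)
  ultimately have "\<exists>\<nu> r. prob_space \<nu> \<and> sets \<nu> = sets borel \<and> strict_mono r \<and>
      (\<forall>f. continuous_on UNIV f \<longrightarrow> (\<lambda>k. \<Sum>y\<in>S (r k). w' (r k) y * f y) \<longlonglongrightarrow> (\<integral>x. f x \<partial>\<nu>))"
    by (intro circle_weak_limit S)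
  then obtain \<nu> r where \<nu>: "prob_space \<nu>" "sets \<nu> = sets borel" and r: "strict_mono (r :: nat \<Rightarrow> nat)"
    and lim: "\<And>f. continuous_on UNIV f \<Longrightarrow> (\<lambda>k. \<Sum>y\<in>S (r k). w' (r k) y * f y) \<longlonglongrightarrow> (\<integral>x. f x \<partial>\<nu>)"
    by blast
  \<comment> \<open>A subsequence suffices: \<open>osc\<close> compares time n with all later times
    and all points, so letting k tend to infinity gives the bound for every n and x.\<close>
  have "\<bar>(L ^^ n) f x / iter_one n x - (\<integral>x. f x \<partial>\<nu>)\<bar> \<le> C * \<kappa> ^ n * H"
    if f: "holder_with \<alpha> H f" for f H n x
  proof (rule tendsto_upperbound)
    have "(\<lambda>k. (L ^^ r k) f x0 / iter_one (r k) x0) \<longlonglongrightarrow> (\<integral>x. f x \<partial>\<nu>)"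
      using lim[OF holder_with_imp_continuous[OF f alpha]] by (simp add: eq')
    thus "(\<lambda>k. \<bar>(L ^^ n) f x / iter_one n x - (L ^^ r k) f x0 / iter_one (r k) x0\<bar>)
        \<longlonglongrightarrow> \<bar>(L ^^ n) f x / iter_one n x - (\<integral>x. f x \<partial>\<nu>)\<bar>"
      by (intro tendsto_intros)
    show "\<forall>\<^sub>F k in sequentially.
        \<bar>(L ^^ n) f x / iter_one n x - (L ^^ r k) f x0 / iter_one (r k) x0\<bar> \<le> C * \<kappa> ^ n * H"
      using eventually_ge_at_top[of n]
    proof eventually_elim
      case (elim k)
      hence "n \<le> r k" using seq_suble[OF r, of k] by linarith
      thus ?case using osc[OF f, of n x "r k - n" x0] by simp
    qed
  qed simp
  show ?thesis
    by (rule that[OF C \<nu>]) fact+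
qed

lemma rpf_spectral_gap: "rpf_with_spectral_gap (holder_space \<alpha>) (holder_norm \<alpha>) L"
proof (rule conformal_measure)
  fix C \<kappa> and \<nu> :: "circle measure"
  assume C: "1 \<le> C" and kappa: "0 < \<kappa>" "\<kappa> < 1"
    and \<nu>: "prob_space \<nu>" "sets \<nu> = sets borel"
    and hol: "\<And>f H n. holder_with \<alpha> H f \<Longrightarrow> holder_with \<alpha> (C * \<kappa> ^ n * H) (\<lambda>x. (L ^^ n) f x / iter_one n x)"
    and conv: "\<And>f H n x. holder_with \<alpha> H f \<Longrightarrow>
      \<bar>(L ^^ n) f x / iter_one n x - (\<integral>x. f x \<partial>\<nu>)\<bar> \<le> C * \<kappa> ^ n * H"
  interpret \<nu>: prob_space \<nu> by (rule \<nu>)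
  have fin: "finite_measure \<nu>" by (rule \<nu>.finite_measure_axioms)
  note holder_cont = holder_with_imp_continuous[OF holder_with_holder_const alpha]
  have integrable: "integrable \<nu> f" if "f \<in> holder_space \<alpha>" for f
    using holder_cont[OF that] by (rule integrable_circle_continuous[OF fin \<nu>(2)])
  have kappa_lim: "(\<lambda>n. C * \<kappa> ^ n * H) \<longlonglongrightarrow> 0" for H
  proof -
    have "(\<lambda>n. C * \<kappa> ^ n * H) \<longlonglongrightarrow> C * 0 * H"
      using kappa by (intro tendsto_intros LIMSEQ_realpow_zero) auto
    thus ?thesis by simp
  qed
  have lim: "(\<lambda>n. (L ^^ n) f x / iter_one n x) \<longlonglongrightarrow> (\<integral>x. f x \<partial>\<nu>)" if f: "f \<in> holder_space \<alpha>" for f x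
  proof -
    obtain H where H: "holder_with \<alpha> H f" using f by (rule holder_spaceE)
    have "(\<lambda>n. (L ^^ n) f x / iter_one n x - (\<integral>x. f x \<partial>\<nu>)) \<longlonglongrightarrow> 0"
      by (rule Lim_null_comparison[OF _ kappa_lim[of H]]) (use conv[OF H] in auto)
    thus ?thesis by (simp add: LIM_zero_iff)
  qed
  have one: "(\<lambda>_. 1) \<in> holder_space \<alpha>"
    by (rule holder_spaceI[OF holder_with_const[OF order_refl]])
  \<comment> \<open>Testing the eigenmeasure identity on the function 1 leaves no other choice, as
    \<nu> is a probability.\<close>
  define \<rho> where "\<rho> = (\<integral>x. L (\<lambda>_. 1) x \<partial>\<nu>)"
  \<comment> \<open>L^n (L f) / L^n 1 is the product of L^n (L 1) / L^n 1, which tends to \<rho>,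
    and L^(n+1) f / L^(n+1) 1, which tends to the integral of f.\<close>
  have eigen: "(\<integral>x. L f x \<partial>\<nu>) = \<rho> * (\<integral>x. f x \<partial>\<nu>)" if f: "f \<in> holder_space \<alpha>" for f
  proof (rule LIMSEQ_unique)
    fix x :: circle
    show "(\<lambda>n. (L ^^ n) (L f) x / iter_one n x) \<longlonglongrightarrow> (\<integral>x. L f x \<partial>\<nu>)"
      by (rule lim[OF L_holder_space[OF f]])
    have "(\<lambda>n. (L ^^ Suc n) f x / iter_one (Suc n) x) \<longlonglongrightarrow> (\<integral>x. f x \<partial>\<nu>)"
      using lim[OF f, of x] by (rule LIMSEQ_Suc)
    moreover have "(\<lambda>n. (L ^^ n) (L (\<lambda>_. 1)) x / iter_one n x) \<longlonglongrightarrow> \<rho>"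
      unfolding \<rho>_def by (rule lim[OF L_holder_space[OF one]])
    ultimately have "(\<lambda>n. ((L ^^ n) (L (\<lambda>_. 1)) x / iter_one n x) * ((L ^^ Suc n) f x / iter_one (Suc n) x))
        \<longlonglongrightarrow> \<rho> * (\<integral>x. f x \<partial>\<nu>)"
      by (intro tendsto_mult)
    moreover have "((L ^^ n) (L (\<lambda>_. 1)) x / iter_one n x) * ((L ^^ Suc n) f x / iter_one (Suc n) x)
        = (L ^^ n) (L f) x / iter_one n x" for n
    proof -
      have "(L ^^ n) (L (\<lambda>_. 1)) x = iter_one (Suc n) x" "(L ^^ n) (L f) x = (L ^^ Suc n) f x"
        by (simp_all add: iter_one_def funpow_Suc_right del: funpow.simps)
      thus ?thesis using iter_one_pos[of "Suc n" x] by simp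
    qed
    ultimately show "(\<lambda>n. (L ^^ n) (L f) x / iter_one n x) \<longlonglongrightarrow> \<rho> * (\<integral>x. f x \<partial>\<nu>)"
      by simp
  qed
  have iter_hs: "iter_one n \<in> holder_space \<alpha>" for n
    by (induction n) (use one L_holder_space in \<open>auto simp: iter_one_def\<close>)
  have int_iter: "(\<integral>x. iter_one n x \<partial>\<nu>) = \<rho> ^ n" for n
  proof (induction n)
    case 0
    show ?case by (simp add: iter_one_def \<nu>.prob_space)
  next
    case (Suc n)
    show ?case using eigen[OF iter_hs[of n]] Suc.IH by (simp add: iter_one_Suc)
  qed
  have comp: "iter_one n x \<le> exp K * iter_one n y" for n x y
    by (rule log_holder_with_le[OF iter_one_log_holder]) (use alpha K in auto)
  \<comment> \<open>Distortion compares L^n 1 with its \<nu>-mean, and this mean is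
    \<rho>^n.\<close>
  have bounds: "iter_one n x \<le> exp K * \<rho> ^ n" "\<rho> ^ n \<le> exp K * iter_one n x" for n x
  proof -
    have "(\<integral>y. iter_one n x \<partial>\<nu>) \<le> (\<integral>y. exp K * iter_one n y \<partial>\<nu>)"
      by (rule integral_mono) (use comp integrable[OF iter_hs] in auto)
    thus "iter_one n x \<le> exp K * \<rho> ^ n"
      by (simp add: int_iter \<nu>.prob_space)
    have "(\<integral>y. iter_one n y \<partial>\<nu>) \<le> (\<integral>y. exp K * iter_one n x \<partial>\<nu>)"
      by (rule integral_mono) (use comp integrable[OF iter_hs] in auto)
    thus "\<rho> ^ n \<le> exp K * iter_one n x"
      by (simp add: int_iter \<nu>.prob_space)
  qed
  have rho: "0 < \<rho>"
  proof -
    fix x :: circle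
    have "0 < exp K * \<rho> ^ 1"
      using iter_one_pos[of 1 x] bounds(1)[of 1 x] by linarith
    thus ?thesis by (simp add: zero_less_mult_iff)
  qed
  define v where "v n x = iter_one n x / \<rho> ^ n" for n x
  have v_bounds: "exp (-K) \<le> v n x" "v n x \<le> exp K" for n x
    using bounds(1)[of n x] bounds(2)[of n x] rho by (simp_all add: v_def exp_minus field_simps)
  have v_pos: "0 < v n x" for n x
    using iter_one_pos[of n x] rho by (simp add: v_def)
  obtain H1 where H1: "0 \<le> H1" "holder_with \<alpha> H1 (L (\<lambda>_. 1))"
    using L_holder_space[OF one] by (rule holder_spaceE)
  \<comment> \<open>The growth ratio L^(n+1) 1 / L^n 1 is L^n (L 1) / L^n 1, which approaches \<rho>
    geometrically; hence the increments of v are summable.\<close>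
  have v_diff: "\<bar>v (Suc n) x - v n x\<bar> \<le> exp K * C * H1 / \<rho> * \<kappa> ^ n" for n x
  proof -
    define r where "r = iter_one (Suc n) x / iter_one n x"
    have r: "\<bar>r - \<rho>\<bar> \<le> C * \<kappa> ^ n * H1"
      using conv[OF H1(2), of n x]
      by (simp add: r_def \<rho>_def iter_one_def funpow_swap1)
    have "v (Suc n) x - v n x = v n x * (r - \<rho>) / \<rho>"
      using iter_one_pos[of n x] rho by (simp add: v_def r_def field_simps)
    also have "\<bar>\<dots>\<bar> = v n x * \<bar>r - \<rho>\<bar> / \<rho>"
      using rho v_pos[of n x] by (simp add: abs_mult)
    also have "\<dots> \<le> exp K * (C * \<kappa> ^ n * H1) / \<rho>"
      using r v_bounds[of n x] rho by (intro divide_right_mono mult_mono) auto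
    finally show ?thesis by (simp add: mult_ac)
  qed
  have "convergent (\<lambda>n. v n x)" for x
  proof -
    have "summable (\<lambda>n. exp K * C * H1 / \<rho> * \<kappa> ^ n)"
      using kappa by (intro summable_mult summable_geometric) auto
    hence "summable (\<lambda>n. v (Suc n) x - v n x)"
      by (rule summable_comparison_test') (use v_diff in auto)
    hence "convergent (\<lambda>n. \<Sum>i<n. v (Suc i) x - v i x)"
      by (simp add: summable_iff_convergent)
    thus ?thesis
      by (simp add: sum_lessThan_telescope[of "\<lambda>i. v i x"] convergent_diff_const_right_iff)
  qed
  then obtain h where h: "\<And>x. (\<lambda>n. v n x) \<longlonglongrightarrow> h x"
    unfolding convergent_def by metis
  have h_bounds: "exp (-K) \<le> h x" "h x \<le> exp K" for x
    by (auto intro!: v_bounds intro: LIMSEQ_le_const[OF h] LIMSEQ_le_const2[OF h])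
  have h_pos: "0 < h x" for x
    using h_bounds(1)[of x] exp_gt_zero[of "-K"] by linarith
  have h_log: "log_holder_with \<alpha> K h"
    unfolding log_holder_with_def
  proof (intro conjI allI h_pos)
    fix x y
    show "h x \<le> exp (K * dist x y powr \<alpha>) * h y"
    proof (rule LIMSEQ_le[OF h tendsto_mult_left[OF h]], intro exI allI impI)
      fix n
      show "v n x \<le> exp (K * dist x y powr \<alpha>) * v n y"
        using log_holder_withD(2)[OF iter_one_log_holder, of n x y] rho
        by (simp add: v_def divide_simps)
    qed
  qed
  have h_hs: "h \<in> holder_space \<alpha>"
    using log_holder_with_imp_holder_with[OF h_log K h_bounds(2)] by (rule holder_spaceI)
  have Lh: "L h = (\<lambda>x. \<rho> * h x)"
  proof
    fix x
    have "L (v n) x = \<rho> * v (Suc n) x" for n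
    proof -
      have "v n = (\<lambda>z. inverse (\<rho> ^ n) * iter_one n z)"
        by (auto simp: v_def divide_inverse)
      hence "L (v n) x = inverse (\<rho> ^ n) * iter_one (Suc n) x"
        by (simp add: transfer_op_cmult iter_one_Suc)
      also have "\<dots> = \<rho> * v (Suc n) x"
        using rho by (simp add: v_def field_simps)
      finally show ?thesis .
    qed
    hence "(\<lambda>n. \<rho> * v (Suc n) x) \<longlonglongrightarrow> L h x"
      using transfer_op_tendsto[of v h T A x, OF h] by simp
    moreover have "(\<lambda>n. \<rho> * v (Suc n) x) \<longlonglongrightarrow> \<rho> * h x"
      by (intro tendsto_mult_left LIMSEQ_Suc h)
    ultimately show "L h x = \<rho> * h x" by (rule LIMSEQ_unique)
  qed
  have triple: "rpf_triple (holder_space \<alpha>) L h \<rho> \<nu>"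
    unfolding rpf_triple_def
    using h_hs h_pos rho \<nu>(2) fin \<nu>.emeasure_space_1 Lh eigen by auto
  \<comment> \<open>The factor exp K * (2 + K) collects the sup bound exp K and the two product-rule
    terms K exp K and exp K for the product of L^t f / L^t 1 with L^t 1.\<close>
  define C' where "C' = max 1 (C * exp K * (2 + K))"
  have gap: "holder_norm \<alpha> ((L ^^ t) f) \<le> C' * \<rho> ^ t * (1 - (1 - \<kappa>)) ^ t * holder_norm \<alpha> f"
    if f: "f \<in> holder_space \<alpha>" and int: "(\<integral>x. f x \<partial>\<nu>) = 0" for f t
  proof -
    define H where "H = holder_const \<alpha> f"
    define c where "c = C * \<kappa> ^ t * H"
    have H: "holder_with \<alpha> H f" "0 \<le> H"
      using f by (simp_all add: H_def holder_with_holder_const holder_const_nonneg)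
    define u where "u x = (L ^^ t) f x / iter_one t x" for x
    have c: "0 \<le> c" using C kappa H by (simp add: c_def)
    \<comment> \<open>As the integral of f vanishes, the limit of the ratios is 0, so the sup of u
      is as small as its Hoelder constant.\<close>
    have u: "holder_with \<alpha> c u" "\<bar>u x\<bar> \<le> c" for x
      using hol[OF H(1), of t] conv[OF H(1), of t x] int by (simp_all add: u_def[abs_def] c_def)
    have it: "\<bar>iter_one t x\<bar> \<le> exp K * \<rho> ^ t" for x
      using bounds(1)[of t x] iter_one_pos[of t x] by simp
    have it_hol: "holder_with \<alpha> (K * (exp K * \<rho> ^ t)) (iter_one t)"
      by (rule log_holder_with_imp_holder_with[OF iter_one_log_holder K bounds(1)])
    have eq: "(L ^^ t) f = (\<lambda>x. u x * iter_one t x)"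
      using iter_one_pos less_imp_neq[OF iter_one_pos] by (simp add: u_def less_imp_neq[symmetric])
    have "holder_norm \<alpha> ((L ^^ t) f) \<le> c * (exp K * \<rho> ^ t) +
        (c * (K * (exp K * \<rho> ^ t)) + (exp K * \<rho> ^ t) * c)"
      unfolding eq
    proof (rule holder_normI)
      show "holder_with \<alpha> (c * (K * (exp K * \<rho> ^ t)) + exp K * \<rho> ^ t * c) (\<lambda>x. u x * iter_one t x)"
        by (rule holder_with_mult[OF u it_hol it])
      show "\<bar>u x * iter_one t x\<bar> \<le> c * (exp K * \<rho> ^ t)" for x
        unfolding abs_mult using u(2) it c by (intro mult_mono) auto
    qed
    also have "\<dots> = (C * exp K * (2 + K)) * (\<rho> ^ t * \<kappa> ^ t * H)"
      by (simp add: c_def algebra_simps)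
    also have "\<dots> \<le> C' * (\<rho> ^ t * \<kappa> ^ t * holder_norm \<alpha> f)"
    proof (rule mult_mono)
      show "C * exp K * (2 + K) \<le> C'" by (simp add: C'_def)
      show "\<rho> ^ t * \<kappa> ^ t * H \<le> \<rho> ^ t * \<kappa> ^ t * holder_norm \<alpha> f"
        using rho kappa holder_const_le_norm[OF f alpha] by (intro mult_left_mono) (auto simp: H_def)
    qed (use rho kappa H in \<open>auto simp: C'_def\<close>)
    finally show ?thesis by (simp add: mult_ac)
  qed
  show ?thesis
    unfolding rpf_with_spectral_gap_def
  proof (intro conjI L_acts_continuously exI)
    show "rpf_triple (holder_space \<alpha>) L h \<rho> \<nu>" by (rule triple)
    show "1 \<le> C'" by (simp add: C'_def)
    show "0 < 1 - \<kappa>" "1 - \<kappa> < 1" using kappa by auto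
    show "\<forall>t. \<forall>f\<in>holder_space \<alpha>. (\<integral>x. f x \<partial>\<nu>) = 0 \<longrightarrow>
        holder_norm \<alpha> ((L ^^ t) f) \<le> C' * \<rho> ^ t * (1 - (1 - \<kappa>)) ^ t * holder_norm \<alpha> f"
      using gap by blast
  qed
qed

end

section \<open>Decay of correlations\<close>

text \<open>Closed sets form an intersection-stable generator, and the indicator of a nonempty
  closed set S is the limit of the Lipschitz functions max 0 (1 - n infdist x S). The empty set is
  treated apart because \<open>infdist\<close> to it is 0 everywhere.\<close>

lemma finite_measure_eqI_lipschitz:
  fixes M N :: "'a::metric_space measure"
  assumes sets: "sets M = sets borel" "sets N = sets borel"
    and fin: "finite_measure M" "finite_measure N"
    and eq: "\<And>C g. holder_with 1 C g \<Longrightarrow> (\<And>x. 0 \<le> g x \<and> g x \<le> 1) \<Longrightarrow> (\<integral>x. g x \<partial>M) = (\<integral>x. g x \<partial>N)"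
  shows "M = N"
proof -
  interpret M: finite_measure M by (rule fin)
  interpret N: finite_measure N by (rule fin)
  note [measurable_cong] = sets
  have "measure M S = measure N S" if S: "closed S" for S
  proof (cases "S = {}")
    case False
    define g where "g n x = max 0 (1 - real n * infdist x S)" for n :: nat and x
    have g: "holder_with 1 (real n) (g n)" for n
      unfolding holder_with_def
    proof (intro allI)
      fix x y
      have "\<bar>g n x - g n y\<bar> \<le> \<bar>real n * infdist x S - real n * infdist y S\<bar>"
        by (auto simp: g_def max_def)
      also have "\<dots> = real n * \<bar>infdist x S - infdist y S\<bar>"
        by (simp add: abs_mult flip: right_diff_distrib)
      also have "\<dots> \<le> real n * dist x y"
        by (intro mult_left_mono infdist_triangle_abs) auto
      finally show "\<bar>g n x - g n y\<bar> \<le> real n * dist x y powr 1" by simp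
    qed
    have bd: "0 \<le> g n x \<and> g n x \<le> 1" for n x
      by (simp add: g_def infdist_nonneg)
    have meas [measurable]: "g n \<in> borel_measurable borel" for n
      by (rule holder_with_measurable[OF g]) simp
    have lim: "(\<lambda>n. g n x) \<longlonglongrightarrow> indicat_real S x" for x
    proof (cases "x \<in> S")
      case True
      thus ?thesis by (simp add: g_def)
    next
      case notin: False
      hence pos: "0 < infdist x S"
        using S False by (metis infdist_pos_not_in_closed)
      have "\<forall>\<^sub>F n in sequentially. 1 / infdist x S \<le> real n"
        using filterlim_real_sequentially by (simp add: filterlim_at_top)
      hence "\<forall>\<^sub>F n in sequentially. g n x = 0"
        by eventually_elim (use pos in \<open>simp add: g_def field_simps\<close>)
      thus ?thesis using notin by (simp add: tendsto_eventually)
    qed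
    have S_meas [measurable]: "S \<in> sets borel" using S by simp
    have "(\<lambda>n. \<integral>x. g n x \<partial>M) \<longlonglongrightarrow> (\<integral>x. indicat_real S x \<partial>M)"
      by (rule integral_dominated_convergence[where w = "\<lambda>_. 1"]) (use lim bd in auto)
    moreover have "(\<lambda>n. \<integral>x. g n x \<partial>N) \<longlonglongrightarrow> (\<integral>x. indicat_real S x \<partial>N)"
      by (rule integral_dominated_convergence[where w = "\<lambda>_. 1"]) (use lim bd in auto)
    ultimately have "(\<integral>x. indicat_real S x \<partial>M) = (\<integral>x. indicat_real S x \<partial>N)"
      using eq[OF g bd] LIMSEQ_unique by auto
    moreover have "S \<in> sets M" "S \<in> sets N" by measurable
    ultimately show ?thesis
      using M.finite_emeasure_space N.finite_emeasure_space by (simp add: sets.sets_into_space Int_absorb1 Int_absorb2)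
  qed simp
  hence "emeasure M S = emeasure N S" if "closed S" for S
    using that by (simp add: M.emeasure_eq_measure N.emeasure_eq_measure)
  moreover have "sets (borel :: 'a measure) = sigma_sets UNIV (Collect closed)"
    by (simp add: borel_eq_closed)
  ultimately show ?thesis
    using sets by (intro measure_eqI_generator_eq[where E = "Collect closed" and \<Omega> = UNIV and A = "\<lambda>_. UNIV"])
      (auto simp: Int_stable_def M.emeasure_eq_measure)
qed

text \<open>On the fibre over x the factor g (T z) is constant and leaves the sum; this is the
  source of the duality with composition by T.\<close>

lemma transfer_op_comp:
  "transfer_op T A (\<lambda>z. f z * g (T z)) = (\<lambda>x. transfer_op T A f x * g x)"
  unfolding transfer_op_def sum_distrib_right by (intro ext sum.cong) auto

context paired_map
begin

text \<open>The infimal convolution with \<open>n\<close> times the distance regularizes.\<close>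

lemma lipschitz_approx:
  fixes f :: "'a \<Rightarrow> real"
  assumes f: "holder_with a H f" and a: "0 < a" and H: "0 \<le> H" and e: "0 < e"
  shows "\<exists>n g. 0 \<le> n \<and> holder_with 1 n g \<and> (\<forall>x. \<bar>f x - g x\<bar> \<le> e)"
proof -
  define \<eta> where "\<eta> = (e / (H + 1)) powr (1 / a)"
  have eta: "0 < \<eta>" using e H by (simp add: \<eta>_def)
  have "H * \<eta> powr a = e * (H / (H + 1))"
    using a e H by (simp add: \<eta>_def powr_powr)
  also have "\<dots> \<le> e" using e H by (intro mult_left_le) auto
  finally have small: "H * \<eta> powr a \<le> e" .
  define n where "n = H / \<eta>"
  have n: "0 \<le> n" using H eta by (simp add: n_def)
  \<comment> \<open>Up to distance \<eta> the Hoelder term is at most e; beyond it the slope n = H /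
    \<eta> wins, since the Hoelder term never exceeds H on a space of diameter at most 1.\<close>
  have key: "H * dist x y powr a - n * dist x y \<le> e" for x y :: 'a
  proof (cases "dist x y \<le> \<eta>")
    case True
    hence "H * dist x y powr a \<le> H * \<eta> powr a"
      using H a by (intro mult_left_mono powr_mono2) auto
    moreover have "0 \<le> n * dist x y" using n by simp
    ultimately show ?thesis using small by linarith
  next
    case False
    have "H * dist x y powr a \<le> H * 1"
      using H a by (intro mult_left_mono dist_powr_le_1) auto
    also have "\<dots> = n * \<eta>" using eta by (simp add: n_def)
    also have "\<dots> \<le> n * dist x y" using False n by (intro mult_left_mono) auto
    finally show ?thesis using e by simp
  qed
  define g where "g x = (INF y. f y + n * dist x y)" for x
  have lower: "f x - e \<le> f y + n * dist x y" for x y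
    using holder_withD[OF f, of x y] key[of x y] by linarith
  hence bdd: "bdd_below (range (\<lambda>y. f y + n * dist x y))" for x
    by (intro bdd_belowI[of _ "f x - e"]) auto
  have "g x \<le> f x" for x
    unfolding g_def by (rule cINF_lower2[OF bdd, of x]) auto
  moreover have "f x - e \<le> g x" for x
    unfolding g_def by (rule cINF_greatest) (use lower in auto)
  moreover have "g x - g y \<le> n * dist x y" for x y
  proof -
    have "g x - n * dist x y \<le> g y"
      unfolding g_def[of y]
    proof (rule cINF_greatest)
      fix z
      have "g x \<le> f z + n * dist x z"
        unfolding g_def by (rule cINF_lower[OF bdd]) simp
      also have "n * dist x z \<le> n * (dist x y + dist y z)"
        using n by (intro mult_left_mono dist_triangle) auto
      finally show "g x - n * dist x y \<le> f z + n * dist y z" by (simp add: algebra_simps)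
    qed simp
    thus ?thesis by simp
  qed
  hence "holder_with 1 n g"
    by (auto simp: holder_with_def abs_le_iff dist_commute)
      (metis dist_commute)
  ultimately show ?thesis
    using n e by (intro exI[of _ n] exI[of _ g]) (auto simp: abs_le_iff algebra_simps)
qed

end

context flat_potential
begin

text \<open>The eigenmeasure identity is only given for \<alpha>-Hoelder functions, whereas the
  claim concerns any Hoelder f and integrable g. The duality between the normalized operator and
  composition with T is therefore widened in stages: Lipschitz f and g, then Hoelder f by uniform
  approximation, then integrable g by an equality of measures.\<close>

lemma rpf_decay:
  assumes lip: "\<And>x y. dist (T x) (T y) \<le> M * dist x y" and M: "0 \<le> M" and alpha1: "\<alpha> \<le> 1"
    and triple: "rpf_triple (holder_space \<alpha>) L h \<rho> \<nu>"
    and \<mu>: "\<mu> = density \<nu> (\<lambda>x. ennreal (h x))" "prob_space \<mu>"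
  shows "exp_decay_of_correlations T \<mu>"
proof -
  from triple have h: "h \<in> holder_space \<alpha>" and h_pos: "\<And>x. 0 < h x" and rho: "0 < \<rho>"
    and nu: "sets \<nu> = sets borel" "finite_measure \<nu>"
    and Lh: "L h = (\<lambda>x. \<rho> * h x)"
    and eigen: "\<And>f. f \<in> holder_space \<alpha> \<Longrightarrow> (\<integral>x. L f x \<partial>\<nu>) = \<rho> * (\<integral>x. f x \<partial>\<nu>)"
    by (auto simp: rpf_triple_def)
  interpret \<mu>: prob_space \<mu> by (rule \<mu>)
  note [measurable_cong] = nu(1)
  have mu_sets [measurable_cong]: "sets \<mu> = sets borel" by (simp add: \<mu> nu)
  obtain Hh where Hh: "0 \<le> Hh" "holder_with \<alpha> Hh h" using h by (rule holder_spaceE)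
  have h_cont: "continuous_on UNIV h" by (rule holder_with_imp_continuous[OF Hh(2) alpha])
  have h_meas [measurable]: "h \<in> borel_measurable borel"
    by (rule borel_measurable_continuous_onI[OF h_cont])
  have T_cont: "continuous_on UNIV T"
    by (rule lipschitz_on_continuous_on[of M]) (use lip M in \<open>auto intro: lipschitz_onI\<close>)
  have T_meas [measurable]: "T \<in> borel_measurable borel"
    by (rule borel_measurable_continuous_onI[OF T_cont])
  obtain z0 where z0: "\<And>x. h z0 \<le> h x"
    using continuous_attains_inf[OF compact_UNIV_circle _ h_cont] by auto

  \<comment> \<open>Conjugating by h and dividing by \<rho> gives an averaging operator: it fixes
    constants, is monotone and does not increase sup distances.\<close>
  define P where "P f x = L (\<lambda>z. f z * h z) x / (\<rho> * h x)" for f x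
  have P_add: "P (\<lambda>x. f x + g x) = (\<lambda>x. P f x + P g x)" for f g
    by (auto simp: P_def distrib_right transfer_op_add add_divide_distrib)
  have P_cmult: "P (\<lambda>x. c * f x) = (\<lambda>x. c * P f x)" for c f
    by (auto simp: P_def mult.assoc transfer_op_cmult)
  have P_const: "P (\<lambda>_. c) = (\<lambda>_. c)" for c
    using h_pos rho less_imp_neq[OF h_pos] by (auto simp: P_def transfer_op_cmult Lh)
  have P_mono: "P f x \<le> P g x" if "\<And>z. f z \<le> g z" for f g x
    unfolding P_def using that h_pos rho
    by (intro divide_right_mono transfer_op_mono mult_right_mono) (auto simp: less_imp_le)
  have P_near: "\<bar>P f x - P g x\<bar> \<le> e" if "\<And>z. \<bar>f z - g z\<bar> \<le> e" for f g x e
  proof -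
    have "P f x \<le> P (\<lambda>z. g z + e) x" "P g x \<le> P (\<lambda>z. f z + e) x"
      using that by (auto intro!: P_mono simp: abs_le_iff algebra_simps)
    thus ?thesis by (auto simp: P_add P_const abs_le_iff)
  qed
  have L_P: "L (\<lambda>z. f z * h z) x = \<rho> * h x * P f x" for f x
    using h_pos[of x] rho by (simp add: P_def)

  have int_mu: "(\<integral>x. f x \<partial>\<mu>) = (\<integral>x. h x * f x \<partial>\<nu>)" if "f \<in> borel_measurable borel" for f :: "circle \<Rightarrow> real"
    unfolding \<mu> using that h_pos by (subst integral_density) (auto simp: less_imp_le)
  have integrable: "integrable \<mu> f" if "continuous_on UNIV f" for f :: "circle \<Rightarrow> real"
    by (rule integrable_circle_continuous[OF \<mu>.finite_measure_axioms mu_sets that])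

  have bounded: "\<exists>B. \<forall>x. \<bar>f x\<bar> \<le> B" if "holder_with b H f" "0 < b" for b H and f :: "circle \<Rightarrow> real"
    by (rule continuous_circle_bounded[OF holder_with_imp_continuous[OF that]])
  have comp_T: "\<exists>G'. holder_with 1 G' (\<lambda>x. g (T x))" if "holder_with 1 G g" for G and g :: "circle \<Rightarrow> real"
  proof -
    have "\<bar>g (T x) - g (T y)\<bar> \<le> G * M * dist x y powr 1" for x y
    proof -
      have "\<bar>g (T x) - g (T y)\<bar> \<le> G * dist (T x) (T y)"
        using holder_withD[OF that, of "T x" "T y"] by simp
      also have "\<dots> \<le> G * (M * dist x y)"
        using holder_with_nonneg[OF that] by (intro mult_left_mono lip)
      finally show ?thesis by (simp add: mult.assoc)
    qed
    thus ?thesis by (auto simp: holder_with_def)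
  qed
  \<comment> \<open>The function f h (g o T) is \<alpha>-Hoelder, since T is Lipschitz and \<alpha>
    \<le> 1, so the eigenmeasure identity applies to it.\<close>
  have duality_lip: "(\<integral>x. P f x * g x \<partial>\<mu>) = (\<integral>x. f x * g (T x) \<partial>\<mu>)"
    if f: "holder_with 1 F f" and g: "holder_with 1 G g" for f g F G
  proof -
    obtain Bf where Bf: "\<And>x. \<bar>f x\<bar> \<le> Bf" using bounded[OF f] by auto
    obtain Bh where Bh: "\<And>x. \<bar>h x\<bar> \<le> Bh" using bounded[OF Hh(2) alpha] by auto
    obtain Bg where Bg: "\<And>x. \<bar>g x\<bar> \<le> Bg" using bounded[OF g] by auto
    obtain G' where G': "holder_with 1 G' (\<lambda>x. g (T x))" using comp_T[OF g] by blast
    have lift: "holder_with \<alpha> C u" if "holder_with 1 C u" for C and u :: "circle \<Rightarrow> real"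
      by (rule holder_with_mono[OF that alpha1 order_refl holder_with_nonneg[OF that]])
    have fh: "holder_with \<alpha> (Bf * Hh + Bh * F) (\<lambda>x. f x * h x)"
      by (rule holder_with_mult[OF lift[OF f] Bf Hh(2) Bh])
    have "holder_with \<alpha> ((Bf * Bh) * G' + Bg * (Bf * Hh + Bh * F)) (\<lambda>x. f x * h x * g (T x))"
    proof (rule holder_with_mult[OF fh _ lift[OF G'] Bg])
      show "\<bar>f x * h x\<bar> \<le> Bf * Bh" for x
        unfolding abs_mult by (intro mult_mono' Bf Bh) auto
    qed
    hence u: "(\<lambda>x. f x * h x * g (T x)) \<in> holder_space \<alpha>" by (rule holder_spaceI)
    have "continuous_on UNIV (L (\<lambda>x. f x * h x))"
      using holder_with_imp_continuous[OF holder_with_holder_const[OF L_holder_space[OF holder_spaceI[OF fh]]] alpha] .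
    hence Pf: "continuous_on UNIV (P f)"
      unfolding P_def[abs_def] using h_pos rho less_imp_neq[OF h_pos]
      by (intro continuous_intros h_cont) (auto simp: less_imp_neq[symmetric])
    have [measurable]: "P f \<in> borel_measurable borel" "g \<in> borel_measurable borel"
      "f \<in> borel_measurable borel" "(\<lambda>x. g (T x)) \<in> borel_measurable borel"
      by (rule borel_measurable_continuous_onI[OF Pf])
        (rule holder_with_measurable, rule f g G', simp)+
    have "(\<integral>x. P f x * g x \<partial>\<mu>) = (\<integral>x. L (\<lambda>x. f x * h x * g (T x)) x / \<rho> \<partial>\<nu>)"
    proof -
      have "(\<integral>x. P f x * g x \<partial>\<mu>) = (\<integral>x. h x * (P f x * g x) \<partial>\<nu>)" by (rule int_mu) simp
      moreover have "L (\<lambda>x. f x * h x * g (T x)) x / \<rho> = h x * (P f x * g x)" for x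
        using rho unfolding transfer_op_comp[of T A "\<lambda>x. f x * h x" g] L_P by simp
      ultimately show ?thesis by simp
    qed
    also have "\<dots> = (\<integral>x. f x * h x * g (T x) \<partial>\<nu>)"
      using eigen[OF u] rho by simp
    also have "\<dots> = (\<integral>x. f x * g (T x) \<partial>\<mu>)"
      by (subst int_mu) (auto simp: mult_ac)
    finally show ?thesis .
  qed

  show ?thesis
    unfolding exp_decay_of_correlations_def
  proof (intro allI impI)
    fix a :: real assume a: "0 < a \<and> a \<le> 1"
    \<comment> \<open>b \<le> \<alpha> keeps A and h Hoelder, b \<le> a keeps the observable
      Hoelder; the constants do not grow because the diameter is at most 1.\<close>
    define b where "b = min a \<alpha>"
    have b: "0 < b" "b \<le> a" "b \<le> \<alpha>" "b \<le> 1" using a alpha by (auto simp: b_def)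
    \<comment> \<open>h is bounded below by its minimum \<open>h z0\<close>; dividing by it and
      using 1 + t \<le> exp t turns a Hoelder constant into a log-Hoelder constant.\<close>
    define Kh where "Kh = Hh / h z0"
    have Kh: "0 \<le> Kh" using Hh h_pos[of z0] by (simp add: Kh_def)
    have h_log: "log_holder_with b Kh h"
      unfolding log_holder_with_def
    proof (intro conjI allI h_pos)
      fix x y
      have "holder_with b Hh h" by (rule holder_with_mono[OF Hh(2) b(3) order_refl Hh(1)])
      hence "h x \<le> h y + Hh * dist x y powr b" using holder_withD[of b Hh h x y] by linarith
      also have "\<dots> = h y + Kh * dist x y powr b * h z0"
        using h_pos[of z0] by (simp add: Kh_def)
      also have "\<dots> \<le> h y + Kh * dist x y powr b * h y"
        using Kh z0 by (intro add_left_mono mult_left_mono) auto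
      also have "\<dots> = (1 + Kh * dist x y powr b) * h y" by (simp add: algebra_simps)
      also have "\<dots> \<le> exp (Kh * dist x y powr b) * h y"
        using h_pos[of y] exp_ge_add_one_self by (intro mult_right_mono) (auto simp: less_imp_le)
      finally show "h x \<le> exp (Kh * dist x y powr b) * h y" .
    qed
    have A_b: "holder_with b KA A" by (rule holder_with_mono[OF A b(3) order_refl KA])
    show "\<exists>C \<delta>. 0 < C \<and> 0 < \<delta> \<and> \<delta> < 1 \<and> (\<forall>f\<in>holder_space a. \<forall>g. integrable \<mu> g \<longrightarrow> (\<forall>t.
        \<bar>(\<integral>x. f x * g ((T ^^ t) x) \<partial>\<mu>) - (\<integral>x. f x \<partial>\<mu>) * (\<integral>x. g x \<partial>\<mu>)\<bar>
          \<le> C * (1 - \<delta>) ^ t * holder_const a f * (\<integral>x. \<bar>g x\<bar> \<partial>\<mu>)))"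
    proof (rule contraction[OF b(1) KA Kh A_b])
      fix C \<kappa> :: real
      assume C: "1 \<le> C" "0 < \<kappa>" "\<kappa> < 1"
        and contr: "\<And>k f H t. (\<And>n. log_holder_with b Kh (k n)) \<Longrightarrow> (\<And>n. L (k n) = k (Suc n)) \<Longrightarrow>
          (\<And>n. L (\<lambda>z. f n z * k n z) = (\<lambda>z. f (Suc n) z * k (Suc n) z)) \<Longrightarrow>
          0 \<le> H \<Longrightarrow> holder_with b H (f 0) \<Longrightarrow> holder_with b (C * \<kappa> ^ t * H) (f t)"
      have P_hol: "holder_with b (C * \<kappa> ^ t * H) ((P ^^ t) f)" if f: "holder_with b H f" for f H t
      proof (rule contr[of "\<lambda>n x. \<rho> ^ n * h x" "\<lambda>n. (P ^^ n) f"])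
        show "log_holder_with b Kh (\<lambda>x. \<rho> ^ n * h x)" for n
          using rho by (intro log_holder_with_cmult[OF h_log]) simp
        show "L (\<lambda>x. \<rho> ^ n * h x) = (\<lambda>x. \<rho> ^ Suc n * h x)" for n
          unfolding transfer_op_cmult Lh by (simp add: mult_ac)
        show "L (\<lambda>z. (P ^^ n) f z * (\<rho> ^ n * h z)) = (\<lambda>z. (P ^^ Suc n) f z * (\<rho> ^ Suc n * h z))" for n
        proof -
          have "(\<lambda>z. (P ^^ n) f z * (\<rho> ^ n * h z)) = (\<lambda>z. \<rho> ^ n * ((P ^^ n) f z * h z))"
            by (simp add: mult_ac)
          thus ?thesis
            by (simp only: transfer_op_cmult L_P) (simp add: mult_ac)
        qed
        show "0 \<le> H" by (rule holder_with_nonneg[OF f])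
        show "holder_with b H ((P ^^ 0) f)" using f by simp
      qed
      have P_cont: "continuous_on UNIV (P f)" if f: "holder_with b H f" for f H
        using holder_with_imp_continuous[OF P_hol[OF f, of 1] b(1)] by simp
      have meas: "f \<in> borel_measurable borel" "P f \<in> borel_measurable borel" if f: "holder_with b H f" for f H
        by (rule borel_measurable_continuous_onI, rule holder_with_imp_continuous[OF f b(1)])
           (rule borel_measurable_continuous_onI, rule P_cont[OF f])
      have duality_g_lip: "(\<integral>x. P f x * g x \<partial>\<mu>) = (\<integral>x. f x * g (T x) \<partial>\<mu>)"
        if f: "holder_with b F f" and g: "holder_with 1 G g" for f g F G
      proof -
        obtain Bg where Bg: "\<And>x. \<bar>g x\<bar> \<le> Bg" using bounded[OF g] by auto
        have Bg0: "0 \<le> Bg" using Bg[of z0] by linarith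
        have g_cont: "continuous_on UNIV g" using g by (rule holder_with_imp_continuous) simp
        have gT_cont: "continuous_on UNIV (\<lambda>x. g (T x))"
          by (rule continuous_on_compose2[OF g_cont T_cont]) simp
        have near: "\<bar>(\<integral>x. u x * w x \<partial>\<mu>) - (\<integral>x. v x * w x \<partial>\<mu>)\<bar> \<le> e * Bg"
          if "continuous_on UNIV u" "continuous_on UNIV v" "continuous_on UNIV w"
            "\<And>x. \<bar>u x - v x\<bar> \<le> e" "\<And>x. \<bar>w x\<bar> \<le> Bg" for e and u v w :: "circle \<Rightarrow> real"
        proof -
          have "(\<integral>x. u x * w x \<partial>\<mu>) - (\<integral>x. v x * w x \<partial>\<mu>) = (\<integral>x. (u x - v x) * w x \<partial>\<mu>)"
            by (subst Bochner_Integration.integral_diff[symmetric])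
              (auto intro!: integrable continuous_intros that simp: left_diff_distrib)
          also have "\<bar>\<dots>\<bar> \<le> (\<integral>x. \<bar>(u x - v x) * w x\<bar> \<partial>\<mu>)"
            by (rule integral_abs_bound)
          also have "\<dots> \<le> (\<integral>x. e * Bg \<partial>\<mu>)"
          proof (rule integral_mono)
            show "\<bar>(u x - v x) * w x\<bar> \<le> e * Bg" for x
              unfolding abs_mult using that(4)[of x] that(5)[of x] by (intro mult_mono) auto
          qed (auto intro!: integrable continuous_intros that)
          finally show ?thesis by (simp add: \<mu>.prob_space)
        qed
        have "\<bar>(\<integral>x. P f x * g x \<partial>\<mu>) - (\<integral>x. f x * g (T x) \<partial>\<mu>)\<bar> \<le> 0 + e" if "0 < e" for e
        proof -
          \<comment> \<open>Two approximation errors of at most e' Bg each have to stay below e; the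
            added 1 guards against Bg = 0.\<close>
          define e' where "e' = e / (2 * (Bg + 1))"
          have e': "0 < e'" using that Bg0 by (simp add: e'_def)
          obtain n f' where f': "holder_with 1 n f'" "\<And>x. \<bar>f x - f' x\<bar> \<le> e'" "0 \<le> n"
            using lipschitz_approx[OF f b(1) holder_with_nonneg[OF f] e'] by blast
          have f'_b: "holder_with b n f'" by (rule holder_with_mono[OF f'(1) b(4) order_refl f'(3)])
          have 1: "\<bar>(\<integral>x. P f x * g x \<partial>\<mu>) - (\<integral>x. P f' x * g x \<partial>\<mu>)\<bar> \<le> e' * Bg"
            by (rule near[OF P_cont[OF f] P_cont[OF f'_b] g_cont P_near[OF f'(2)] Bg])
          have 2: "\<bar>(\<integral>x. f x * g (T x) \<partial>\<mu>) - (\<integral>x. f' x * g (T x) \<partial>\<mu>)\<bar> \<le> e' * Bg"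
            by (rule near[OF holder_with_imp_continuous[OF f b(1)] holder_with_imp_continuous[OF f'_b b(1)] gT_cont f'(2) Bg])
          have "2 * (e' * Bg) \<le> e" using that Bg0 by (simp add: e'_def field_simps)
          thus ?thesis using 1 2 duality_lip[OF f'(1) g] by linarith
        qed
        hence "\<bar>(\<integral>x. P f x * g x \<partial>\<mu>) - (\<integral>x. f x * g (T x) \<partial>\<mu>)\<bar> \<le> 0"
          by (rule field_le_epsilon)
        thus ?thesis by simp
      qed
      \<comment> \<open>For nonnegative f the duality says that two finite measures agree on
        Lipschitz functions; their equality then allows any integrable g.\<close>
      have measures_eq: "distr (density \<mu> (\<lambda>x. ennreal (f x))) borel T = density \<mu> (\<lambda>x. ennreal (P f x))"
        if f: "holder_with b F f" and pos: "\<And>x. 0 \<le> f x" for f F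
      proof (rule finite_measure_eqI_lipschitz)
        note [measurable] = meas[OF f]
        have P_pos: "0 \<le> P f x" for x
          using P_mono[of "\<lambda>_. 0" f x] pos P_const[of 0] by simp
        have fin: "finite_measure (density \<mu> (\<lambda>x. ennreal (u x)))"
          if "continuous_on UNIV u" "\<And>x. 0 \<le> u x" for u
        proof (rule finite_measureI)
          have u: "integrable \<mu> u" by (rule integrable[OF that(1)])
          hence "emeasure (density \<mu> (\<lambda>x. ennreal (u x))) (space \<mu>) = (\<integral>\<^sup>+x. ennreal (u x) \<partial>\<mu>)"
            by (subst emeasure_density) (auto intro!: nn_integral_cong)
          also have "\<dots> = ennreal (\<integral>x. u x \<partial>\<mu>)"
            using u that by (intro nn_integral_eq_integral) auto
          finally show "emeasure (density \<mu> (\<lambda>x. ennreal (u x))) (space (density \<mu> (\<lambda>x. ennreal (u x)))) \<noteq> \<infinity>"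
            by simp
        qed
        show "finite_measure (distr (density \<mu> (\<lambda>x. ennreal (f x))) borel T)"
          by (rule finite_measure.finite_measure_distr[OF fin[OF holder_with_imp_continuous[OF f b(1)] pos]]) simp
        show "finite_measure (density \<mu> (\<lambda>x. ennreal (P f x)))"
          by (rule fin[OF P_cont[OF f] P_pos])
        fix G and g :: "circle \<Rightarrow> real" assume g: "holder_with 1 G g"
        have [measurable]: "g \<in> borel_measurable borel" by (rule holder_with_measurable[OF g]) simp
        have "(\<integral>x. g x \<partial>distr (density \<mu> (\<lambda>x. ennreal (f x))) borel T) = (\<integral>x. f x * g (T x) \<partial>\<mu>)"
          using pos by (subst integral_distr; simp?; subst integral_density; simp?)
        also have "\<dots> = (\<integral>x. P f x * g x \<partial>\<mu>)" by (rule duality_g_lip[OF f g, symmetric])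
        also have "\<dots> = (\<integral>x. g x \<partial>density \<mu> (\<lambda>x. ennreal (P f x)))"
          using P_pos by (subst integral_density) auto
        finally show "(\<integral>x. g x \<partial>distr (density \<mu> (\<lambda>x. ennreal (f x))) borel T) =
            (\<integral>x. g x \<partial>density \<mu> (\<lambda>x. ennreal (P f x)))" .
      qed (simp_all add: mu_sets)
      have one: "holder_with b 0 (\<lambda>_. 1)" by (rule holder_with_const) simp
      \<comment> \<open>The case f = 1, as P fixes constants: \<mu> is invariant under T, so
        composition with T preserves integrability.\<close>
      have distr_T: "distr \<mu> borel T = \<mu>"
        using measures_eq[OF one] by (simp add: P_const density_1 one_ennreal_def[symmetric])
      have int_T: "integrable \<mu> (\<lambda>x. g (T x))" if "integrable \<mu> g" for g :: "circle \<Rightarrow> real"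
        using that by (subst (asm) distr_T[symmetric]) (rule integrable_distr, measurable)
      have int_T_pow: "integrable \<mu> (\<lambda>x. g ((T ^^ t) x))" if "integrable \<mu> g" for g :: "circle \<Rightarrow> real" and t
      proof (induction t)
        case (Suc t)
        from int_T[OF this] show ?case by (simp add: funpow_swap1)
      qed (use that in simp)
      have integrable_mult: "integrable \<mu> (\<lambda>x. u x * g x)"
        if u: "holder_with b U u" and g: "integrable \<mu> g" for u U and g :: "circle \<Rightarrow> real"
      proof -
        obtain B where B: "\<And>x. \<bar>u x\<bar> \<le> B" using bounded[OF u b(1)] by auto
        have [measurable]: "u \<in> borel_measurable borel" "g \<in> borel_measurable borel"
          using meas(1)[OF u] borel_measurable_integrable[OF g] by simp_all
        show ?thesis
        proof (rule Bochner_Integration.integrable_bound)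
          show "integrable \<mu> (\<lambda>x. B * \<bar>g x\<bar>)" using g by simp
          show "AE x in \<mu>. norm (u x * g x) \<le> norm (B * \<bar>g x\<bar>)"
            using B by (auto simp: abs_mult intro!: AE_I2 mult_right_mono order_trans[OF B abs_ge_self])
        qed measurable
      qed
      have duality: "(\<integral>x. f x * g (T x) \<partial>\<mu>) = (\<integral>x. P f x * g x \<partial>\<mu>)"
        if f: "holder_with b F f" and g: "integrable \<mu> g" for f g F
      proof -
        have [measurable]: "g \<in> borel_measurable borel"
          using borel_measurable_integrable[OF g] by simp
        have nonneg: "(\<integral>x. f x * g (T x) \<partial>\<mu>) = (\<integral>x. P f x * g x \<partial>\<mu>)"
          if f: "holder_with b F f" and pos: "\<And>x. 0 \<le> f x" for f F
        proof -
          note [measurable] = meas[OF f]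
          have P_pos: "0 \<le> P f x" for x
            using P_mono[of "\<lambda>_. 0" f x] pos P_const[of 0] by simp
          have "(\<integral>x. f x * g (T x) \<partial>\<mu>) = (\<integral>x. g x \<partial>distr (density \<mu> (\<lambda>x. ennreal (f x))) borel T)"
            using pos by (subst integral_distr; simp?; subst integral_density; simp?)
          also have "\<dots> = (\<integral>x. g x \<partial>density \<mu> (\<lambda>x. ennreal (P f x)))"
            by (simp only: measures_eq[OF f pos])
          also have "\<dots> = (\<integral>x. P f x * g x \<partial>\<mu>)"
            using P_pos by (subst integral_density) auto
          finally show ?thesis .
        qed
        \<comment> \<open>A signed f is made nonnegative by adding a bound B; the identity for the
          constant B is subtracted afterwards.\<close>
        obtain B where B: "\<And>x. \<bar>f x\<bar> \<le> B" using bounded[OF f b(1)] by auto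
        have c: "holder_with b 0 (\<lambda>_. B)" by (rule holder_with_const) simp
        have B0: "0 \<le> B" using B[of z0] by linarith
        have fB: "0 \<le> f x + B" for x using B[of x] by linarith
        have "(\<integral>x. (f x + B) * g (T x) \<partial>\<mu>) = (\<integral>x. P (\<lambda>x. f x + B) x * g x \<partial>\<mu>)"
          by (rule nonneg[OF holder_with_add[OF f c] fB])
        moreover have "(\<integral>x. B * g (T x) \<partial>\<mu>) = (\<integral>x. P (\<lambda>x. B) x * g x \<partial>\<mu>)"
          by (rule nonneg[OF c B0])
        moreover have "(\<integral>x. (f x + B) * g (T x) \<partial>\<mu>) = (\<integral>x. f x * g (T x) \<partial>\<mu>) + (\<integral>x. B * g (T x) \<partial>\<mu>)"
          unfolding distrib_right
          by (intro Bochner_Integration.integral_add integrable_mult[OF f] integrable_mult[OF c] int_T g)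
        moreover have "(\<integral>x. P (\<lambda>x. f x + B) x * g x \<partial>\<mu>) = (\<integral>x. P f x * g x \<partial>\<mu>) + (\<integral>x. P (\<lambda>x. B) x * g x \<partial>\<mu>)"
          unfolding P_add distrib_right
          using P_hol[OF f, of 1] P_hol[OF c, of 1]
          by (intro Bochner_Integration.integral_add integrable_mult g) auto
        ultimately show ?thesis by simp
      qed
      have duality_pow: "(\<integral>x. f x * g ((T ^^ t) x) \<partial>\<mu>) = (\<integral>x. (P ^^ t) f x * g x \<partial>\<mu>)"
        if f: "holder_with b F f" and g: "integrable \<mu> g" for f g F t
        using f
      proof (induction t arbitrary: f F)
        case (Suc t)
        have "(\<integral>x. f x * g ((T ^^ Suc t) x) \<partial>\<mu>) = (\<integral>x. f x * g ((T ^^ t) (T x)) \<partial>\<mu>)"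
          by (simp add: funpow_swap1)
        also have "\<dots> = (\<integral>x. P f x * g ((T ^^ t) x) \<partial>\<mu>)"
          by (rule duality[OF Suc.prems int_T_pow[OF g]])
        also have "\<dots> = (\<integral>x. (P ^^ t) (P f) x * g x \<partial>\<mu>)"
          using P_hol[OF Suc.prems, of 1] by (intro Suc.IH) simp
        finally show ?case by (simp add: funpow_swap1)
      qed simp
      show ?thesis
      proof (intro exI conjI ballI allI impI)
        show "0 < C" "0 < 1 - \<kappa>" "1 - \<kappa> < 1" using C by auto
        fix f and g :: "circle \<Rightarrow> real" and t
        assume f: "f \<in> holder_space a" and g: "integrable \<mu> g"
        define H where "H = holder_const a f"
        have H: "0 \<le> H" "holder_with b H f"
          using holder_const_nonneg[OF f]
            holder_with_mono[OF holder_with_holder_const[OF f] b(2) order_refl] by (simp_all add: H_def)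
        define c where "c = C * \<kappa> ^ t * H"
        define u where "u = (P ^^ t) f"
        define m where "m = (\<integral>x. f x \<partial>\<mu>)"
        have u: "holder_with b c u" unfolding u_def c_def by (rule P_hol[OF H(2)])
        have c: "0 \<le> c" using holder_with_nonneg[OF u] .
        have int_u: "integrable \<mu> u" by (rule integrable[OF holder_with_imp_continuous[OF u b(1)]])
        have m: "m = (\<integral>x. u x \<partial>\<mu>)"
          using duality_pow[OF H(2), of "\<lambda>_. 1" t] by (simp add: m_def u_def)
        \<comment> \<open>u has the same mean as f and oscillation at most c, so it is uniformly
          within c of that mean. A sup bound is what pairs with the L^1 norm of g.\<close>
        have u_near: "\<bar>u x - m\<bar> \<le> c" for x
        proof -
          have "u x - m = (\<integral>y. u x - u y \<partial>\<mu>)"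
            using int_u by (simp add: m \<mu>.prob_space)
          also have "\<bar>\<dots>\<bar> \<le> (\<integral>y. \<bar>u x - u y\<bar> \<partial>\<mu>)" by (rule integral_abs_bound)
          also have "\<dots> \<le> (\<integral>y. c \<partial>\<mu>)"
            using holder_with_osc[OF u] b c int_u by (intro integral_mono) auto
          finally show ?thesis by (simp add: \<mu>.prob_space)
        qed
        have "(\<integral>x. f x * g ((T ^^ t) x) \<partial>\<mu>) - (\<integral>x. f x \<partial>\<mu>) * (\<integral>x. g x \<partial>\<mu>)
            = (\<integral>x. u x * g x \<partial>\<mu>) - (\<integral>x. m * g x \<partial>\<mu>)"
          by (simp add: duality_pow[OF H(2) g] u_def m_def)
        also have "\<dots> = (\<integral>x. (u x - m) * g x \<partial>\<mu>)"
          using integrable_mult[OF u g] g by (simp add: left_diff_distrib)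
        also have "\<bar>\<dots>\<bar> \<le> (\<integral>x. \<bar>(u x - m) * g x\<bar> \<partial>\<mu>)" by (rule integral_abs_bound)
        also have "\<dots> \<le> (\<integral>x. c * \<bar>g x\<bar> \<partial>\<mu>)"
        proof (rule integral_mono)
          show "integrable \<mu> (\<lambda>x. \<bar>(u x - m) * g x\<bar>)"
            using integrable_mult[OF u g] g by (simp add: left_diff_distrib)
          show "\<bar>(u x - m) * g x\<bar> \<le> c * \<bar>g x\<bar>" for x
            unfolding abs_mult by (intro mult_right_mono u_near) simp
        qed (use g in simp)
        finally show "\<bar>(\<integral>x. f x * g ((T ^^ t) x) \<partial>\<mu>) - (\<integral>x. f x \<partial>\<mu>) * (\<integral>x. g x \<partial>\<mu>)\<bar>
            \<le> C * (1 - (1 - \<kappa>)) ^ t * holder_const a f * (\<integral>x. \<bar>g x\<bar> \<partial>\<mu>)"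
          using g by (simp add: c_def H_def)
      qed
    qed
  qed
qed

end

section \<open>Pomeau--Manneville maps\<close>

definition pm_branch :: "real \<Rightarrow> real \<Rightarrow> real"
  where "pm_branch q r = (1 + (2 * r) powr q) * r"

section \<open>Branches, preimages and Lipschitz continuity of the map\<close>

lemma coord_bounds: "0 \<le> coord x" "coord x < 1"
  using coord[of x] by auto

lemma frac_id: "0 \<le> r \<Longrightarrow> r < 1 \<Longrightarrow> frac r = r"
  by (simp add: frac_eq)

lemma circle_of_minus_1: "circle_of (r - 1) = circle_of r"
  using frac_1_eq[of "r - 1"] by (simp add: circle_of_def)

lemma pomeau_manneville_eq:
  "pomeau_manneville q x =
    circle_of (if coord x \<le> 1/2 then pm_branch q (coord x) else 2 * coord x - 1)"
  by (simp add: pomeau_manneville_def pm_branch_def)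

text \<open>In (2v)^q v - (2u)^q u, replacing (2u)^q by (2v)^q only lowers the difference. The
  excess expansion is thus governed by the endpoint farther from 0.\<close>

lemma pm_branch_expand:
  assumes "0 < q" "0 \<le> u" "u \<le> v"
  shows "(1 + (2 * v) powr q) * (v - u) \<le> pm_branch q v - pm_branch q u"
proof -
  have "(2 * u) powr q * u \<le> (2 * v) powr q * u"
    using assms by (intro mult_right_mono powr_mono2) auto
  thus ?thesis by (simp add: pm_branch_def algebra_simps)
qed

lemma pm_branch_less:
  assumes "0 < q" "0 \<le> u" "u < v"
  shows "pm_branch q u < pm_branch q v"
proof -
  have "0 < (1 + (2 * v) powr q) * (v - u)"
    using assms by (intro mult_pos_pos add_pos_nonneg) auto
  thus ?thesis using pm_branch_expand[of q u v] assms by simp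
qed

lemma pm_branch_0 [simp]: "pm_branch q 0 = 0"
  by (simp add: pm_branch_def)

lemma pm_branch_half [simp]: "pm_branch q (1/2) = 1"
  by (simp add: pm_branch_def)

lemma pm_branch_nonneg: "0 \<le> u \<Longrightarrow> 0 \<le> pm_branch q u"
  by (simp add: pm_branch_def)

lemma pm_branch_le:
  assumes "0 < q" "0 \<le> u" "u \<le> 1/2"
  shows "pm_branch q u \<le> 2 * u"
proof -
  have "(2 * u) powr q \<le> 1" using assms by (intro powr_le1) auto
  hence "(1 + (2 * u) powr q) * u \<le> 2 * u" using assms by (intro mult_right_mono) auto
  thus ?thesis by (simp add: pm_branch_def)
qed

text \<open>The slope of the branch is 1 + (1 + q) (2r)^q, and 2 + q is its value at r =
  1/2.\<close>

lemma pm_branch_lipschitz: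
  assumes q: "0 < q" and uv: "0 \<le> u" "u \<le> v" "v \<le> 1/2"
  shows "pm_branch q v - pm_branch q u \<le> (2 + q) * (v - u)"
proof -
  have "(2 + q) * u - pm_branch q u \<le> (2 + q) * v - pm_branch q v"
  proof (rule DERIV_nonneg_imp_increasing_open[OF uv(2)])
    show "continuous_on {u..v} (\<lambda>r. (2 + q) * r - pm_branch q r)"
      unfolding pm_branch_def by (intro continuous_intros continuous_on_powr') (use uv q in auto)
    fix r assume r: "u < r" "r < v"
    have "(2 * r) powr q \<le> 1" using r uv q by (intro powr_le1) auto
    hence "q * (2 * r) powr q \<le> q" using q by (intro mult_left_le) auto
    moreover have "((\<lambda>r. (2 + q) * r - pm_branch q r) has_real_derivative
        (2 + q) - (1 + (2 * r) powr q + (q * (2 * r) powr (q - 1) * 2) * r)) (at r)"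
      unfolding pm_branch_def using r uv by (auto intro!: derivative_eq_intros)
    moreover have "(2 * r) powr (q - 1) * 2 * r = (2 * r) powr q"
      using r uv powr_mult_base[of "2 * r" "q - 1"] by (simp add: mult_ac)
    ultimately show "\<exists>y. ((\<lambda>r. (2 + q) * r - pm_branch q r) has_real_derivative y) (at r) \<and> 0 \<le> y"
      using \<open>(2 * r) powr q \<le> 1\<close> by (intro exI conjI) (auto simp: mult.assoc)
  qed
  thus ?thesis by (simp add: algebra_simps)
qed

lemma ex_pm_branch:
  assumes q: "0 < q"
  shows "\<exists>u. 0 \<le> u \<and> u < 1/2 \<and> coord x = pm_branch q u \<and> x = circle_of (pm_branch q u)"
proof -
  have "\<exists>u\<ge>0. u \<le> 1/2 \<and> pm_branch q u = coord x"
  proof (rule IVT')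
    show "continuous_on {0..1/2} (pm_branch q)"
      unfolding pm_branch_def[abs_def] by (intro continuous_intros continuous_on_powr') (use q in auto)
  qed (use coord_bounds[of x] in auto)
  then obtain u where u: "0 \<le> u" "u \<le> 1/2" "pm_branch q u = coord x" by blast
  moreover have "u \<noteq> 1/2" using u(3) coord_bounds(2)[of x] pm_branch_half[of q] by force
  ultimately show ?thesis by (intro exI[of _ u]) auto
qed

lemma pm_preimages:
  assumes q: "0 < q" and u: "0 \<le> u" "u < 1/2"
  shows "{z. pomeau_manneville q z = circle_of (pm_branch q u)} =
      {circle_of u, circle_of ((1 + pm_branch q u) / 2)}"
    and "circle_of u \<noteq> circle_of ((1 + pm_branch q u) / 2)"
proof -
  define X where "X = pm_branch q u"
  have X: "0 \<le> X" "X < 1"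
    using pm_branch_nonneg[of u q] pm_branch_less[OF q u] u by (auto simp: X_def)
  have cX: "coord (circle_of X) = X" using X by (simp add: frac_id)
  have c0: "coord (circle_of u) = u" using u by (simp add: frac_id)
  have c1: "coord (circle_of ((1 + X) / 2)) = (1 + X) / 2" using X by (simp add: frac_id)
  show "circle_of u \<noteq> circle_of ((1 + pm_branch q u) / 2)"
    using c0 c1 u X by (metis X_def add_increasing2 divide_right_mono linorder_not_less order_refl zero_le_numeral)
  have "z = circle_of u \<or> z = circle_of ((1 + X) / 2)" if "pomeau_manneville q z = circle_of X" for z
  proof -
    define c where "c = coord z"
    have c: "0 \<le> c" "c < 1" "z = circle_of c" using coord_bounds[of z] by (simp_all add: c_def)
    have fr: "frac (if c \<le> 1/2 then pm_branch q c else 2 * c - 1) = X"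
      using that cX by (metis pomeau_manneville_eq coord_circle_of c_def)
    consider "c < 1/2" | "c = 1/2" | "1/2 < c" by linarith
    thus ?thesis
    proof cases
      case 1
      hence "pm_branch q c < 1" using pm_branch_less[OF q c(1), of "1/2"] by simp
      hence "pm_branch q c = pm_branch q u"
        using fr 1 pm_branch_nonneg[OF c(1), of q] by (simp add: frac_id X_def)
      hence "c = u" using pm_branch_less[OF q c(1), of u] pm_branch_less[OF q u(1), of c] by linarith
      thus ?thesis using c by simp
    next
      \<comment> \<open>At 1/2 the left formula applies and gives 1, which is 0 on the circle; so
        1/2 is the right preimage (1 + 0) / 2 of 0.\<close>
      case 2
      have "X = 0" using fr unfolding 2 by simp
      thus ?thesis using c 2 by simp
    next
      case 3
      hence "2 * c - 1 = X" using fr c by (simp add: frac_id)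
      hence "c = (1 + X) / 2" by simp
      thus ?thesis using c(3) by blast
    qed
  qed
  moreover have "pomeau_manneville q (circle_of u) = circle_of X"
    using u by (simp add: pomeau_manneville_eq frac_id X_def)
  moreover have "pomeau_manneville q (circle_of ((1 + X) / 2)) = circle_of X"
  proof (cases "X = 0")
    case True
    have "circle_of 1 = circle_of 0" using circle_of_minus_1[of 1] by simp
    moreover have half: "coord (circle_of ((1 + X) / 2)) = 1 / 2" using c1 True by simp
    have "pomeau_manneville q (circle_of ((1 + X) / 2)) = circle_of (pm_branch q (1 / 2))"
      unfolding pomeau_manneville_eq half by simp
    ultimately show ?thesis using True by simp
  next
    case False
    thus ?thesis using X c1 by (simp add: pomeau_manneville_eq field_simps del: coord_circle_of)
  qed
  ultimately show "{z. pomeau_manneville q z = circle_of (pm_branch q u)} =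
      {circle_of u, circle_of ((1 + pm_branch q u) / 2)}"
    unfolding X_def by blast
qed

text \<open>\<psi> lifts the map to an increasing function from 0 to 2 on [0,1]. For the arc through
  0, the image of y is represented by \<psi> Y - 2, the same point of the circle, and the increments
  over [0,X] and [Y,1] are added.\<close>

lemma pomeau_manneville_lipschitz:
  assumes q: "0 < q"
  shows "dist (pomeau_manneville q x) (pomeau_manneville q y) \<le> (2 + q) * dist x y"
proof -
  define \<psi> where "\<psi> r = (if r \<le> 1/2 then pm_branch q r else 2 * r)" for r
  have psi: "pomeau_manneville q x = circle_of (\<psi> (coord x))" for x
    using circle_of_minus_1[of "2 * coord x"] by (simp add: pomeau_manneville_eq \<psi>_def)
  have incr: "\<psi> r \<le> \<psi> s \<and> \<psi> s - \<psi> r \<le> (2 + q) * (s - r)" if "0 \<le> r" "r \<le> s" "s \<le> 1" for r s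
  proof -
    consider "s \<le> 1/2" | "r \<le> 1/2" "1/2 < s" | "1/2 < r" by linarith
    thus ?thesis
    proof cases
      case 1
      thus ?thesis
        using that pm_branch_lipschitz[OF q that(1,2) 1] pm_branch_less[OF q that(1), of s]
        by (cases "r = s") (auto simp: \<psi>_def)
    next
      case 2
      have "pm_branch q r \<le> 1"
        using pm_branch_le[OF q that(1) 2(1)] 2 by linarith
      moreover have "1 - pm_branch q r \<le> (2 + q) * (1/2 - r)"
        using pm_branch_lipschitz[OF q that(1) 2(1)] by simp
      moreover have "2 * (s - 1/2) \<le> (2 + q) * (s - 1/2)"
        using 2 q by (intro mult_right_mono) auto
      ultimately show ?thesis using 2 by (simp add: \<psi>_def algebra_simps)
    next
      case 3
      have "2 * (s - r) \<le> (2 + q) * (s - r)"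
        using that q by (intro mult_right_mono) auto
      thus ?thesis using 3 that by (simp add: \<psi>_def)
    qed
  qed
  have main: "dist (pomeau_manneville q x) (pomeau_manneville q y) \<le> (2 + q) * dist x y"
    if le: "coord x \<le> coord y" for x y
  proof -
    define X Y where "X = coord x" and "Y = coord y"
    have XY: "0 \<le> X" "X \<le> Y" "Y < 1"
      using le coord_bounds[of x] coord_bounds[of y] by (simp_all add: X_def Y_def)
    have d: "dist x y = min (Y - X) (1 - (Y - X))"
      using XY by (simp add: dist_circle_def X_def Y_def)
    have "dist (pomeau_manneville q x) (pomeau_manneville q y) \<le> (2 + q) * (Y - X)"
      using dist_circle_of_le[of "\<psi> X" "\<psi> Y"] incr[of X Y] XY by (simp add: psi X_def Y_def)
    moreover have "dist (pomeau_manneville q x) (pomeau_manneville q y) \<le> (2 + q) * (1 - (Y - X))"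
    proof -
      have "circle_of (\<psi> Y) = circle_of (\<psi> Y - 2)"
        using circle_of_minus_1[of "\<psi> Y"] circle_of_minus_1[of "\<psi> Y - 1"] by simp
      hence "dist (pomeau_manneville q x) (pomeau_manneville q y) \<le> \<bar>\<psi> X - (\<psi> Y - 2)\<bar>"
        using dist_circle_of_le[of "\<psi> X" "\<psi> Y - 2"] by (simp add: psi X_def Y_def)
      moreover have "\<psi> 0 = 0" "\<psi> 1 = 2" by (simp_all add: \<psi>_def)
      ultimately show ?thesis
        using incr[of 0 X] incr[of Y 1] XY by (simp add: algebra_simps)
    qed
    ultimately show ?thesis unfolding d by (auto simp: min_def)
  qed
  show ?thesis
    using main[of x y] main[of y x] by (cases "coord x \<le> coord y") (auto simp: dist_commute)
qed

text \<open>(1 + \<tau>)^\<alpha> \<ge> 1 + \<alpha> ln (1 + \<tau>), and ln (1 + \<tau>) \<ge>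
  \<tau> / 2 on [0,1]. Expansion by 1 + \<tau> thus leaves a gain proportional to \<tau>, against
  which the variation of A is charged.\<close>

lemma powr_gain:
  fixes \<alpha> \<tau> d D :: real
  assumes "0 < \<alpha>" "0 \<le> \<tau>" "\<tau> \<le> 1" "0 \<le> d" "(1 + \<tau>) * d \<le> D"
  shows "\<alpha> / 2 * \<tau> * d powr \<alpha> \<le> D powr \<alpha> - d powr \<alpha>"
proof -
  have "1 - ln (1 + \<tau>) = 1 + ln (inverse (1 + \<tau>))" using assms by (simp add: ln_inverse)
  also have "\<dots> \<le> inverse (1 + \<tau>)"
    using ln_le_minus_one[of "inverse (1 + \<tau>)"] assms by simp
  also have "\<dots> \<le> 1 - \<tau> / 2"
  proof -
    have "\<tau> * \<tau> \<le> \<tau> * 1" using assms by (intro mult_left_mono) auto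
    thus ?thesis using assms by (simp add: field_simps)
  qed
  finally have "\<tau> / 2 \<le> ln (1 + \<tau>)" by simp
  hence "1 + \<alpha> * (\<tau> / 2) \<le> 1 + \<alpha> * ln (1 + \<tau>)" using assms by simp
  also have "\<dots> \<le> (1 + \<tau>) powr \<alpha>"
    using assms exp_ge_add_one_self[of "\<alpha> * ln (1 + \<tau>)"] by (simp add: powr_def)
  finally have "(1 + \<alpha> * (\<tau> / 2)) * d powr \<alpha> \<le> (1 + \<tau>) powr \<alpha> * d powr \<alpha>"
    by (rule mult_right_mono) simp
  also have "\<dots> = ((1 + \<tau>) * d) powr \<alpha>" using assms by (simp add: powr_mult)
  also have "\<dots> \<le> D powr \<alpha>" using assms by (intro powr_mono2) auto
  finally show ?thesis by (simp add: algebra_simps)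
qed

section \<open>Potentials that are flat at the neutral fixed point\<close>

lemma holder_with_circle_of:
  assumes "holder_with a H f" "0 \<le> a"
  shows "\<bar>f (circle_of r) - f (circle_of s)\<bar> \<le> H * \<bar>r - s\<bar> powr a"
proof -
  have "\<bar>f (circle_of r) - f (circle_of s)\<bar> \<le> H * dist (circle_of r) (circle_of s) powr a"
    by (rule holder_withD[OF assms(1)])
  also have "\<dots> \<le> H * \<bar>r - s\<bar> powr a"
    using assms holder_with_nonneg[OF assms(1)]
    by (intro mult_left_mono powr_mono2 dist_circle_of_le) auto
  finally show ?thesis .
qed

text \<open>The two estimates below are the only places where the neutral fixed point matters: pairs
  in the left branch, and pairs of preimages on both sides of \<open>0\<close>.\<close>

definition pm_flat :: "real \<Rightarrow> real \<Rightarrow> real \<Rightarrow> (circle \<Rightarrow> real) \<Rightarrow> bool"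
  where "pm_flat q \<alpha> K A \<longleftrightarrow>
    (\<forall>u v. 0 \<le> u \<and> u \<le> v \<and> v \<le> 1/2 \<longrightarrow>
      \<bar>A (circle_of u) - A (circle_of v)\<bar> \<le> K * (2 * v) powr q * (v - u) powr \<alpha>) \<and>
    (\<forall>u s. 0 \<le> u \<and> u \<le> 1/2 \<and> 0 \<le> s \<and> s \<le> 1/2 \<longrightarrow>
      \<bar>A (circle_of u) - A (circle_of (- s))\<bar> \<le> K * (u + s) powr (\<alpha> + q))"

text \<open>The exponent \<alpha> + q is split: (v - u)^q is at most (2v)^q, and (v - u)^\<alpha> is
  kept.\<close>

lemma holder_imp_pm_flat:
  assumes q: "0 < q" and \<alpha>: "0 < \<alpha>" and \<gamma>: "\<alpha> + q \<le> \<gamma>" and A: "holder_with \<gamma> H A"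
  shows "pm_flat q \<alpha> H A"
  unfolding pm_flat_def
proof (intro conjI allI impI; elim conjE)
  have H: "0 \<le> H" by (rule holder_with_nonneg[OF A])
  have main: "\<bar>A (circle_of r) - A (circle_of s)\<bar> \<le> H * \<bar>r - s\<bar> powr (\<alpha> + q)"
    if "\<bar>r - s\<bar> \<le> 1" for r s
  proof -
    have "\<bar>A (circle_of r) - A (circle_of s)\<bar> \<le> H * \<bar>r - s\<bar> powr \<gamma>"
      by (rule holder_with_circle_of[OF A]) (use q \<alpha> \<gamma> in simp)
    also have "\<dots> \<le> H * \<bar>r - s\<bar> powr (\<alpha> + q)"
      using H that \<gamma> by (intro mult_left_mono powr_mono') auto
    finally show ?thesis .
  qed
  fix u v :: real assume uv: "0 \<le> u" "u \<le> v" "v \<le> 1/2"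
  have "\<bar>A (circle_of u) - A (circle_of v)\<bar> \<le> H * (v - u) powr (\<alpha> + q)"
    using main[of u v] uv by simp
  also have "\<dots> = H * (v - u) powr q * (v - u) powr \<alpha>"
    by (simp add: powr_add mult_ac)
  also have "\<dots> \<le> H * (2 * v) powr q * (v - u) powr \<alpha>"
    using uv q H by (intro mult_right_mono mult_left_mono powr_mono2) auto
  finally show "\<bar>A (circle_of u) - A (circle_of v)\<bar> \<le> H * (2 * v) powr q * (v - u) powr \<alpha>" .
next
  fix u s :: real assume us: "0 \<le> u" "u \<le> 1/2" "0 \<le> s" "s \<le> 1/2"
  have "\<bar>A (circle_of u) - A (circle_of (- s))\<bar> \<le> H * \<bar>u - - s\<bar> powr \<gamma>"
    by (rule holder_with_circle_of[OF A]) (use q \<alpha> \<gamma> in simp)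
  also have "\<dots> \<le> H * (u + s) powr (\<alpha> + q)"
    using holder_with_nonneg[OF A] us \<gamma> by (auto intro!: mult_left_mono powr_mono')
  finally show "\<bar>A (circle_of u) - A (circle_of (- s))\<bar> \<le> H * (u + s) powr (\<alpha> + q)" .
qed

text \<open>Near 0 the mean value theorem bounds the variation by c v^\<gamma> (v - u) on one side
  of 0 and by c (u + s)^(\<gamma>+1) across it; the two conditions on \<gamma> fit these to the two
  required powers. Away from 0 the factor with exponent q is bounded below, and plain Hoelder
  continuity suffices.\<close>

lemma flat_at_0_imp_pm_flat:
  assumes q: "0 < q" and \<alpha>: "0 < \<alpha>" "\<alpha> \<le> 1" and \<gamma>: "q < \<gamma>" "q \<le> \<gamma> + 1 - \<alpha>"
    and A: "A \<in> flat_at_0_potentials \<alpha> \<gamma>"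
  shows "\<exists>K\<ge>0. pm_flat q \<alpha> K A"
proof -
  define B where "B r = A (circle_of r)" for r
  obtain A' \<epsilon> where eps: "0 < \<epsilon>"
    and deriv: "\<And>r. r \<in> {-\<epsilon><..<\<epsilon>} \<Longrightarrow> (B has_real_derivative A' r) (at r)"
    and bigo: "A' \<in> O[at 0](\<lambda>r. \<bar>r\<bar> powr \<gamma>)"
    using A unfolding flat_at_0_potentials_def B_def[abs_def] by blast
  have "A \<in> holder_space \<alpha>" using A by (simp add: flat_at_0_potentials_def)
  then obtain H where H: "0 \<le> H" "holder_with \<alpha> H A" by (rule holder_spaceE)
  have B_hol: "\<bar>B r - B s\<bar> \<le> H * \<bar>r - s\<bar> powr \<alpha>" for r s
    unfolding B_def by (rule holder_with_circle_of[OF H(2)]) (use \<alpha> in simp)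
  obtain c where c: "0 < c" "\<forall>\<^sub>F r in at 0. norm (A' r) \<le> c * norm (\<bar>r\<bar> powr \<gamma>)"
    using bigo by (rule landau_o.bigE)
  then obtain d where d: "0 < d" "\<And>r. r \<noteq> 0 \<Longrightarrow> \<bar>r\<bar> < d \<Longrightarrow> \<bar>A' r\<bar> \<le> c * \<bar>r\<bar> powr \<gamma>"
    unfolding eventually_at by (auto simp: dist_real_def)
  define e where "e = min \<epsilon> d"
  have e: "0 < e" "e \<le> \<epsilon>" "e \<le> d" using eps d by (auto simp: e_def)
  \<comment> \<open>The open interval must avoid 0, because a bound in \<open>O[at 0]\<close> says
    nothing at 0 itself; intervals across 0 are cut there.\<close>
  have mvt: "\<bar>B v - B u\<bar> \<le> c * m powr \<gamma> * (v - u)"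
    if uv: "u \<le> v" "-e < u" "v < e" and m: "\<And>r. u < r \<Longrightarrow> r < v \<Longrightarrow> r \<noteq> 0 \<and> \<bar>r\<bar> \<le> m" for u v m
  proof (cases "u = v")
    case False
    have "\<exists>z>u. z < v \<and> B v - B u = (v - u) * A' z"
      by (rule MVT2) (use False uv e deriv in auto)
    then obtain z where z: "u < z" "z < v" "B v - B u = (v - u) * A' z" by blast
    have "\<bar>A' z\<bar> \<le> c * \<bar>z\<bar> powr \<gamma>" using d(2)[of z] m[OF z(1,2)] z uv e by auto
    also have "\<dots> \<le> c * m powr \<gamma>"
      using c m[OF z(1,2)] q \<gamma> by (intro mult_left_mono powr_mono2) auto
    finally have "(v - u) * \<bar>A' z\<bar> \<le> (v - u) * (c * m powr \<gamma>)"
      using uv by (intro mult_left_mono) auto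
    thus ?thesis using uv by (simp add: z abs_mult mult_ac)
  qed simp
  define K where "K = 2 * c + H / e powr q"
  have K: "2 * c \<le> K" "c \<le> K" "H / e powr q \<le> K" "0 \<le> K" using c H by (auto simp: K_def)
  have "pm_flat q \<alpha> K A"
    unfolding pm_flat_def
  proof (intro conjI allI impI; elim conjE)
    fix u v :: real assume uv: "0 \<le> u" "u \<le> v" "v \<le> 1/2"
    show "\<bar>A (circle_of u) - A (circle_of v)\<bar> \<le> K * (2 * v) powr q * (v - u) powr \<alpha>"
    proof (cases "v < e")
      case True
      have "\<bar>B v - B u\<bar> \<le> c * v powr \<gamma> * (v - u)"
        by (rule mvt) (use uv True e in auto)
      also have "\<dots> \<le> K * (2 * v) powr q * (v - u) powr \<alpha>"
      proof (intro mult_mono)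
        have "v powr \<gamma> \<le> v powr q" using uv \<gamma> by (intro powr_mono') auto
        also have "\<dots> \<le> (2 * v) powr q" using uv q by (intro powr_mono2) auto
        finally show "v powr \<gamma> \<le> (2 * v) powr q" .
        show "v - u \<le> (v - u) powr \<alpha>"
          using powr_mono'[of \<alpha> 1 "v - u"] uv \<alpha> by simp
      qed (use K uv in auto)
      finally show ?thesis by (simp add: B_def abs_minus_commute)
    next
      case False
      have "e powr q \<le> (2 * v) powr q" using False e uv q by (intro powr_mono2) auto
      hence "H * e powr q \<le> H * (2 * v) powr q" using H by (intro mult_left_mono)
      hence "H \<le> H / e powr q * (2 * v) powr q" using e by (simp add: field_simps)
      also have "\<dots> \<le> K * (2 * v) powr q" using K by (intro mult_right_mono) auto
      finally have "H * (v - u) powr \<alpha> \<le> K * (2 * v) powr q * (v - u) powr \<alpha>"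
        by (rule mult_right_mono) simp
      thus ?thesis using B_hol[of u v] uv by (simp add: B_def abs_minus_commute)
    qed
  next
    fix u s :: real assume us: "0 \<le> u" "u \<le> 1/2" "0 \<le> s" "s \<le> 1/2"
    show "\<bar>A (circle_of u) - A (circle_of (- s))\<bar> \<le> K * (u + s) powr (\<alpha> + q)"
    proof (cases "u + s < e")
      case True
      have "\<bar>B u - B 0\<bar> \<le> c * (u + s) powr \<gamma> * (u - 0)"
        by (rule mvt) (use us True e in auto)
      moreover have "\<bar>B 0 - B (- s)\<bar> \<le> c * (u + s) powr \<gamma> * (0 - - s)"
        by (rule mvt) (use us True e in auto)
      ultimately have "\<bar>B u - B (- s)\<bar> \<le> c * (u + s) powr \<gamma> * (u + s)"
        by (simp add: distrib_left)
      also have "\<dots> = c * (u + s) powr (\<gamma> + 1)"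
        using us by (simp add: powr_add)
      also have "\<dots> \<le> K * (u + s) powr (\<alpha> + q)"
        using us K c \<gamma> by (intro mult_mono powr_mono') auto
      finally show ?thesis by (simp add: B_def)
    next
      case False
      have "e powr q \<le> (u + s) powr q" using False e us q by (intro powr_mono2) auto
      hence "H * e powr q \<le> H * (u + s) powr q" using H by (intro mult_left_mono)
      hence "H \<le> H / e powr q * (u + s) powr q" using e by (simp add: field_simps)
      also have "\<dots> \<le> K * (u + s) powr q" using K by (intro mult_right_mono) auto
      finally have "H * (u + s) powr \<alpha> \<le> K * (u + s) powr q * (u + s) powr \<alpha>"
        by (rule mult_right_mono) simp
      thus ?thesis using B_hol[of u "- s"] us by (simp add: B_def powr_add mult_ac)
    qed
  qed
  thus ?thesis using K by blast
qed

text \<open>If the short arc between x and y does not cross 0, preimages in the same branch are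
  matched. Otherwise the left preimage u of x is matched with the right preimage of y, seen as a
  point -s to the left of 0; the other two preimages lie on either side of 1/2 and form the
  contracted pair.\<close>

lemma pm_flat_pairing:
  assumes q: "0 < q" and \<alpha>: "0 < \<alpha>" and A: "holder_with \<alpha> KA A" and K: "0 \<le> K" "pm_flat q \<alpha> K A"
    and le: "coord x \<le> coord y"
  defines "K' \<equiv> 2 * (KA + 2 * K) / \<alpha>"
  shows "\<exists>x0 x1 y0 y1. pairing (pomeau_manneville q) (1/2) x y x0 x1 y0 y1 \<and>
      \<bar>A x0 - A y0\<bar> \<le> K' * (dist x y powr \<alpha> - dist x0 y0 powr \<alpha>) \<and>
      \<bar>A x1 - A y1\<bar> \<le> K' * (dist x y powr \<alpha> - dist x1 y1 powr \<alpha>)"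
proof -
  define d where "d = dist x y"
  have KA: "0 \<le> KA" by (rule holder_with_nonneg[OF A])
  \<comment> \<open>K' \<alpha> / 2 = KA + 2 K: the summand KA covers the contracted pair, whose
    gain has \<tau> = 1, and 2 K covers the neutral pair.\<close>
  have K': "0 \<le> K'" using KA K \<alpha> by (simp add: K'_def)
  have contracted: "\<bar>A z - A w\<bar> \<le> K' * (d powr \<alpha> - dist z w powr \<alpha>)" if "dist z w \<le> 1/2 * d" for z w
  proof -
    have gain: "\<alpha> / 2 * dist z w powr \<alpha> \<le> d powr \<alpha> - dist z w powr \<alpha>"
      using powr_gain[OF \<alpha>, of 1 "dist z w" d] that by simp
    have "\<bar>A z - A w\<bar> \<le> KA * dist z w powr \<alpha>" by (rule holder_withD[OF A])
    also have "\<dots> \<le> (KA + 2 * K) * dist z w powr \<alpha>" using K by (intro mult_right_mono) auto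
    also have "\<dots> = K' * (\<alpha> / 2 * dist z w powr \<alpha>)" using \<alpha> by (simp add: K'_def)
    also have "\<dots> \<le> K' * (d powr \<alpha> - dist z w powr \<alpha>)" using gain K' by (rule mult_left_mono)
    finally show ?thesis .
  qed
  have neutral: "dist z w \<le> d \<and> \<bar>A z - A w\<bar> \<le> K' * (d powr \<alpha> - dist z w powr \<alpha>)"
    if "dist z w \<le> d0" "0 \<le> \<tau>" "\<tau> \<le> 1" "(1 + \<tau>) * d0 \<le> d" "\<bar>A z - A w\<bar> \<le> 2 * K * \<tau> * d0 powr \<alpha>" for z w d0 \<tau>
  proof
    have d0: "0 \<le> d0" using that(1) zero_le_dist[of z w] by linarith
    have "0 \<le> \<tau> * d0" using d0 that by simp
    thus "dist z w \<le> d" using that by (simp add: distrib_right)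
    have "\<bar>A z - A w\<bar> \<le> 2 * K * (\<tau> * d0 powr \<alpha>)" using that(5) by (simp add: mult.assoc)
    also have "\<dots> \<le> (KA + 2 * K) * (\<tau> * d0 powr \<alpha>)"
      using KA that d0 by (intro mult_right_mono) auto
    also have "\<dots> = K' * (\<alpha> / 2 * \<tau> * d0 powr \<alpha>)" using \<alpha> by (simp add: K'_def)
    also have "\<dots> \<le> K' * (d powr \<alpha> - d0 powr \<alpha>)"
      by (intro mult_left_mono powr_gain) (use \<alpha> d0 that K' in auto)
    also have "\<dots> \<le> K' * (d powr \<alpha> - dist z w powr \<alpha>)"
      using K' that(1) \<alpha> by (intro mult_left_mono diff_left_mono powr_mono2) auto
    finally show "\<bar>A z - A w\<bar> \<le> K' * (d powr \<alpha> - dist z w powr \<alpha>)" .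
  qed
  obtain u where u: "0 \<le> u" "u < 1/2" "coord x = pm_branch q u" "x = circle_of (pm_branch q u)"
    using ex_pm_branch[OF q, of x] by blast
  obtain v where v: "0 \<le> v" "v < 1/2" "coord y = pm_branch q v" "y = circle_of (pm_branch q v)"
    using ex_pm_branch[OF q, of y] by blast
  define X Y where "X = coord x" and "Y = coord y"
  have XY: "0 \<le> X" "X \<le> Y" "Y < 1" "X = pm_branch q u" "Y = pm_branch q v"
    using le coord_bounds[of x] coord_bounds[of y] u(3) v(3) by (simp_all add: X_def Y_def)
  have uv: "u \<le> v"
    using pm_branch_less[OF q v(1), of u] XY by (cases "v < u") auto
  have px: "{z. pomeau_manneville q z = x} = {circle_of u, circle_of ((1 + X) / 2)}"
    "circle_of u \<noteq> circle_of ((1 + X) / 2)"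
    using pm_preimages[OF q u(1,2)] u(4) XY(4) by simp_all
  have py: "{z. pomeau_manneville q z = y} = {circle_of v, circle_of ((1 + Y) / 2)}"
    "circle_of v \<noteq> circle_of ((1 + Y) / 2)"
    using pm_preimages[OF q v(1,2)] v(4) XY(5) by simp_all
  have d_eq: "d = min (Y - X) (1 - (Y - X))"
    using XY by (simp add: d_def dist_circle_def X_def Y_def)
  show ?thesis
  proof (cases "Y - X \<le> 1/2")
    case True
    hence d: "d = Y - X" by (simp add: d_eq min_def)
    have 1: "dist (circle_of ((1 + X) / 2)) (circle_of ((1 + Y) / 2)) \<le> 1/2 * d"
    proof -
      have "\<bar>(1 + X) / 2 - (1 + Y) / 2\<bar> = 1/2 * d"
        using XY(2) by (simp add: d abs_if field_simps)
      thus ?thesis using dist_circle_of_le[of "(1 + X) / 2" "(1 + Y) / 2"] by simp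
    qed
    have 0: "dist (circle_of u) (circle_of v) \<le> d \<and>
        \<bar>A (circle_of u) - A (circle_of v)\<bar> \<le> K' * (d powr \<alpha> - dist (circle_of u) (circle_of v) powr \<alpha>)"
    proof (rule neutral)
      show "dist (circle_of u) (circle_of v) \<le> v - u"
        using dist_circle_of_le[of u v] uv by simp
      show "(2 * v) powr q \<le> 1" using v q by (intro powr_le1) auto
      show "(1 + (2 * v) powr q) * (v - u) \<le> d"
        using pm_branch_expand[OF q u(1) uv] by (simp add: d XY)
      have "\<bar>A (circle_of u) - A (circle_of v)\<bar> \<le> K * (2 * v) powr q * (v - u) powr \<alpha>"
        using K(2) u uv v by (simp add: pm_flat_def)
      also have "\<dots> \<le> 2 * K * (2 * v) powr q * (v - u) powr \<alpha>"
        using K(1) by (intro mult_right_mono) auto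
      finally show "\<bar>A (circle_of u) - A (circle_of v)\<bar> \<le> 2 * K * (2 * v) powr q * (v - u) powr \<alpha>" .
    qed simp
    have "pairing (pomeau_manneville q) (1/2) x y (circle_of u) (circle_of ((1 + X) / 2))
        (circle_of v) (circle_of ((1 + Y) / 2))"
      unfolding pairing_def d_def[symmetric] using px py 0 1 by (intro conjI) simp_all
    thus ?thesis
      using conjunct2[OF 0] contracted[OF 1] unfolding d_def
      by (intro exI conjI)
  next
    case False
    hence d: "d = X + (1 - Y)" by (simp add: d_eq min_def)
    define s where "s = (1 - Y) / 2"
    have s: "0 \<le> s" "s \<le> 1/4" using XY False by (auto simp: s_def)
    have minus_s: "- s = (1 + Y) / 2 - 1" by (simp add: s_def field_simps)
    have "circle_of ((1 + Y) / 2) = circle_of (- s)"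
      unfolding minus_s by (rule circle_of_minus_1[symmetric])
    note py' = py[unfolded this]
    have 1: "dist (circle_of ((1 + X) / 2)) (circle_of v) \<le> 1/2 * d"
    proof -
      \<comment> \<open>v lies between Y / 2 and 1/2, hence at least as close to (1 + X) / 2 as Y /
        2, which is at distance d / 2.\<close>
      have "Y \<le> 2 * v" using pm_branch_le[OF q v(1)] v XY by simp
      hence "\<bar>(1 + X) / 2 - v\<bar> \<le> 1/2 * d"
        using XY(1) v(2) by (simp add: d abs_if field_simps)
      thus ?thesis using dist_circle_of_le[of "(1 + X) / 2" v] by linarith
    qed
    have 0: "dist (circle_of u) (circle_of (- s)) \<le> d \<and>
        \<bar>A (circle_of u) - A (circle_of (- s))\<bar> \<le> K' * (d powr \<alpha> - dist (circle_of u) (circle_of (- s)) powr \<alpha>)"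
    proof (rule neutral)
      \<comment> \<open>Left of 0 the map doubles, and the surplus s dominates (2s)^q s, so both
        sides of 0 repel at least like the left branch. The divisor 2 comes from max u s \<ge> (u +
        s) / 2 and is offset by the factor 2 in the hypothesis of \<open>neutral\<close>.\<close>
      define \<tau> where "\<tau> = (u + s) powr q / 2"
      show "dist (circle_of u) (circle_of (- s)) \<le> u + s"
        using dist_circle_of_le[of u "- s"] u s by simp
      have "(u + s) powr q \<le> 1" using u s q by (intro powr_le1) auto
      thus "\<tau> \<le> 1" "0 \<le> \<tau>" by (simp_all add: \<tau>_def)
      have "(2 * s) powr q * s \<le> s"
        using s q by (intro mult_left_le_one_le powr_le1) auto
      moreover have "(u + s) powr q * ((u + s) / 2) \<le> (2 * max u s) powr q * max u s"
        using u s q by (intro mult_mono powr_mono2) auto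
      moreover have "(2 * max u s) powr q * max u s \<le> (2 * u) powr q * u + (2 * s) powr q * s"
        using u s by (simp add: max_def)
      ultimately have "\<tau> * (u + s) \<le> (2 * u) powr q * u + s"
        unfolding \<tau>_def by simp
      moreover have "d = (1 + (2 * u) powr q) * u + 2 * s"
        using XY(4) by (simp add: d s_def pm_branch_def)
      ultimately show "(1 + \<tau>) * (u + s) \<le> d"
        by (simp add: algebra_simps)
      have "\<bar>A (circle_of u) - A (circle_of (- s))\<bar> \<le> K * (u + s) powr (\<alpha> + q)"
        using K(2) u s by (simp add: pm_flat_def)
      also have "\<dots> = 2 * K * \<tau> * (u + s) powr \<alpha>" by (simp add: \<tau>_def powr_add mult_ac)
      finally show "\<bar>A (circle_of u) - A (circle_of (- s))\<bar> \<le> 2 * K * \<tau> * (u + s) powr \<alpha>" .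
    qed
    have "pairing (pomeau_manneville q) (1/2) x y (circle_of u) (circle_of ((1 + X) / 2))
        (circle_of (- s)) (circle_of v)"
      unfolding pairing_def d_def[symmetric] using px py'(1) not_sym[OF py'(2)] 0 1
      by (intro conjI) (simp_all add: insert_commute)
    thus ?thesis
      using conjunct2[OF 0] contracted[OF 1] unfolding d_def
      by (intro exI conjI)
  qed
qed

lemma pm_flat_potential:
  assumes q: "0 < q" and \<alpha>: "0 < \<alpha>" and A: "holder_with \<alpha> KA A" and K: "0 \<le> K" "pm_flat q \<alpha> K A"
  shows "flat_potential (pomeau_manneville q) (1/2) A \<alpha> KA (2 * (KA + 2 * K) / \<alpha>)"
proof -
  define K' where "K' = 2 * (KA + 2 * K) / \<alpha>"
  have KA: "0 \<le> KA" by (rule holder_with_nonneg[OF A])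
  have ex: "\<exists>x0 x1 y0 y1. pairing (pomeau_manneville q) (1/2) x y x0 x1 y0 y1 \<and>
      \<bar>A x0 - A y0\<bar> \<le> K' * (dist x y powr \<alpha> - dist x0 y0 powr \<alpha>) \<and>
      \<bar>A x1 - A y1\<bar> \<le> K' * (dist x y powr \<alpha> - dist x1 y1 powr \<alpha>)" for x y
  proof (cases "coord x \<le> coord y")
    case True
    thus ?thesis unfolding K'_def by (rule pm_flat_pairing[OF q \<alpha> A K])
  next
    case False
    hence "coord y \<le> coord x" by simp
    from pm_flat_pairing[OF q \<alpha> A K this, folded K'_def]
    obtain x0 x1 y0 y1 where *: "pairing (pomeau_manneville q) (1/2) y x y0 y1 x0 x1"
      "\<bar>A y0 - A x0\<bar> \<le> K' * (dist y x powr \<alpha> - dist y0 x0 powr \<alpha>)"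
      "\<bar>A y1 - A x1\<bar> \<le> K' * (dist y x powr \<alpha> - dist y1 x1 powr \<alpha>)" by blast
    have "pairing (pomeau_manneville q) (1/2) x y x0 x1 y0 y1"
      using *(1) by (simp add: pairing_def dist_commute)
    thus ?thesis using *(2,3) by (metis abs_minus_commute dist_commute)
  qed
  show ?thesis
    unfolding K'_def[symmetric]
  proof unfold_locales
    show "dist x y \<le> 1" for x y :: circle using dist_circle_le_half[of x y] by simp
    show "\<exists>x0 x1 y0 y1. pairing (pomeau_manneville q) (1/2) x y x0 x1 y0 y1" for x y
      using ex[of x y] by blast
    show "0 \<le> K'" using KA K \<alpha> by (simp add: K'_def)
  qed (use \<alpha> KA A ex in auto)
qed

theorem theorem1:
  fixes q \<alpha> \<gamma> :: real and A :: "circle \<Rightarrow> real"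
  assumes "q > 0"
    and "(q < 1 \<and> 0 < \<alpha> \<and> \<alpha> < 1 \<and> 0 < \<gamma> \<and> \<gamma> < 1 \<and> \<gamma> - \<alpha> \<ge> q \<and> A \<in> holder_space \<gamma>) \<or>
         (q \<ge> 1 \<and> \<gamma> > q \<and> 0 < \<alpha> \<and> \<alpha> \<le> 1 \<and> \<gamma> + 1 - \<alpha> \<ge> q \<and> A \<in> flat_at_0_potentials \<alpha> \<gamma>)"
  shows "rpf_with_spectral_gap (holder_space \<alpha>) (holder_norm \<alpha>)
           (transfer_op (pomeau_manneville q) A) \<and>
         (\<forall>\<mu>. rpf_measure (holder_space \<alpha>) (transfer_op (pomeau_manneville q) A) \<mu> \<longrightarrow>
           exp_decay_of_correlations (pomeau_manneville q) \<mu>)"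
proof -
  have \<alpha>: "0 < \<alpha>" "\<alpha> \<le> 1" using assms(2) by auto
  have "A \<in> holder_space \<alpha> \<and> (\<exists>K\<ge>0. pm_flat q \<alpha> K A)"
    using assms(2)
  proof
    assume *: "q < 1 \<and> 0 < \<alpha> \<and> \<alpha> < 1 \<and> 0 < \<gamma> \<and> \<gamma> < 1 \<and> \<gamma> - \<alpha> \<ge> q \<and> A \<in> holder_space \<gamma>"
    then obtain H where H: "0 \<le> H" "holder_with \<gamma> H A" using holder_spaceE by blast
    have "pm_flat q \<alpha> H A"
      by (rule holder_imp_pm_flat[OF assms(1) \<alpha>(1) _ H(2)]) (use * in simp)
    moreover have "holder_with \<alpha> H A"
      unfolding holder_with_def
    proof (intro allI)
      fix x y
      have "\<bar>A x - A y\<bar> \<le> H * dist x y powr \<gamma>" by (rule holder_withD[OF H(2)])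
      also have "\<dots> \<le> H * dist x y powr \<alpha>"
        using H * assms(1) dist_circle_le_half[of x y] by (intro mult_left_mono powr_mono') auto
      finally show "\<bar>A x - A y\<bar> \<le> H * dist x y powr \<alpha>" .
    qed
    ultimately show ?thesis using H(1) holder_spaceI by blast
  next
    assume *: "q \<ge> 1 \<and> \<gamma> > q \<and> 0 < \<alpha> \<and> \<alpha> \<le> 1 \<and> \<gamma> + 1 - \<alpha> \<ge> q \<and> A \<in> flat_at_0_potentials \<alpha> \<gamma>"
    thus ?thesis
      using flat_at_0_imp_pm_flat[OF assms(1) \<alpha>, of \<gamma> A] by (simp add: flat_at_0_potentials_def)
  qed
  then obtain KA K where A: "holder_with \<alpha> KA A" and K: "0 \<le> K" "pm_flat q \<alpha> K A"
    using holder_spaceE by blast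
  interpret flat_potential "pomeau_manneville q" "1/2" A \<alpha> KA "2 * (KA + 2 * K) / \<alpha>"
    by (rule pm_flat_potential[OF assms(1) \<alpha>(1) A K])
  have "exp_decay_of_correlations (pomeau_manneville q) \<mu>"
    if "rpf_measure (holder_space \<alpha>) L \<mu>" for \<mu>
    using that rpf_decay[OF pomeau_manneville_lipschitz[OF assms(1)] _ \<alpha>(2)] assms(1)
    unfolding rpf_measure_def by auto
  thus ?thesis using rpf_spectral_gap by blast
qed

end
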